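(* Let $B=\{B_t,t\in\mathbb{R}\}$ be a fractional Brownian motion with Hurst parameter $H\in(0,\frac34)$, let $p\in\{2\}\cup[3,\infty)$, and let $\lambda>1$ be an integer. For $n\ge1$ set $$V_n^p(B)=\sum_{j=0}^{n-1}\big|B_{\frac{j+1}{n}}-B_{\frac jn}\big|^p,\qquad T_{\lambda,n}=\frac{V^p_{\lambda n}(B)}{V^p_n(B)},\qquad \hat H_{\lambda,n}=\frac1p\Big(1-\frac{\log T_{\lambda,n}}{\log\lambda}\Big).$$ Then $$\lim_{n\to\infty}\sqrt{\frac{n}{\log n}}\,\big(\hat H_{\lambda,n}-H\big)=0$$ in probability.
   Context: A fractional Brownian motion with Hurst parameter $H\in(0,1)$ is a zero mean Gaussian process with covariance $\mathbb{E}(B_sB_t)=\frac12(|s|^{2H}+|t|^{2H}-|s-t|^{2H})$. *)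

theory Defs
  imports "HOL-Probability.Probability"
begin

text \<open>The second disjunct admits degenerate Gaussians: a fractional Brownian motion
  vanishes almost surely at time 0.\<close>

definition gaussian_rv :: "'a measure \<Rightarrow> ('a \<Rightarrow> real) \<Rightarrow> bool" where
  "gaussian_rv M X \<longleftrightarrow> X \<in> borel_measurable M \<and>
     ((\<exists>\<mu> \<sigma>. 0 < \<sigma> \<and> distributed M lborel X (normal_density \<mu> \<sigma>)) \<or>
      (\<exists>\<mu>. AE \<omega> in M. X \<omega> = \<mu>))"

text \<open>Joint Gaussianity of all finite-dimensional marginals, expressed through
  their linear combinations.\<close>

definition gaussian_process :: "'a measure \<Rightarrow> ('i \<Rightarrow> 'a \<Rightarrow> real) \<Rightarrow> bool" where
  "gaussian_process M B \<longleftrightarrow>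
     (\<forall>I c. finite I \<longrightarrow> gaussian_rv M (\<lambda>\<omega>. \<Sum>t\<in>I. c t * B t \<omega>))"

text \<open>No path regularity is required. The integrals below exist, as Gaussian
  variables are square integrable.\<close>

definition fractional_brownian_motion ::
    "'a measure \<Rightarrow> real \<Rightarrow> (real \<Rightarrow> 'a \<Rightarrow> real) \<Rightarrow> bool" where
  "fractional_brownian_motion M H B \<longleftrightarrow>
     prob_space M \<and> 0 < H \<and> H < 1 \<and> gaussian_process M B \<and>
     (\<forall>t. integral\<^sup>L M (B t) = 0) \<and>
     (\<forall>s t. integral\<^sup>L M (\<lambda>\<omega>. B s \<omega> * B t \<omega>) =
        (\<bar>s\<bar> powr (2 * H) + \<bar>t\<bar> powr (2 * H) - \<bar>s - t\<bar> powr (2 * H)) / 2)"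

definition power_variation :: "real \<Rightarrow> (real \<Rightarrow> 'a \<Rightarrow> real) \<Rightarrow> nat \<Rightarrow> 'a \<Rightarrow> real" where
  "power_variation p B n \<omega> =
     (\<Sum>j<n. \<bar>B ((real j + 1) / real n) \<omega> - B (real j / real n) \<omega>\<bar> powr p)"

text \<open>For a fractional Brownian motion, the power variation with \<open>n \<ge> 1\<close> is positive
  almost surely, so the totalised values of division and logarithm matter only on a null set.\<close>

definition variation_ratio ::
    "real \<Rightarrow> (real \<Rightarrow> 'a \<Rightarrow> real) \<Rightarrow> nat \<Rightarrow> nat \<Rightarrow> 'a \<Rightarrow> real" where
  "variation_ratio p B L n \<omega> = power_variation p B (L * n) \<omega> / power_variation p B n \<omega>"

definition hurst_estimator ::
    "real \<Rightarrow> (real \<Rightarrow> 'a \<Rightarrow> real) \<Rightarrow> nat \<Rightarrow> nat \<Rightarrow> 'a \<Rightarrow> real" where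
  "hurst_estimator p B L n \<omega> = (1 / p) * (1 - ln (variation_ratio p B L n \<omega>) / ln (real L))"

text \<open>Measurability is demanded explicitly because \<^const>\<open>measure\<close> is 0 on
  non-measurable sets.\<close>

definition converges_in_probability ::
    "'a measure \<Rightarrow> (nat \<Rightarrow> 'a \<Rightarrow> real) \<Rightarrow> ('a \<Rightarrow> real) \<Rightarrow> bool" where
  "converges_in_probability M X Y \<longleftrightarrow>
     (\<forall>n. X n \<in> borel_measurable M) \<and> Y \<in> borel_measurable M \<and>
     (\<forall>\<epsilon>>0. (\<lambda>n. measure M {\<omega> \<in> space M. \<bar>X n \<omega> - Y \<omega>\<bar> > \<epsilon>}) \<longlonglongrightarrow> 0)"

end

theory Submission
  imports Defs
begin

text \<open>Let \<open>m\<close> be the \<open>p\<close>-th absolute moment of a standard normal variable, and let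
  \<open>S n\<close> be the power variation multiplied by \<open>real n powr (p * H - 1)\<close>. It is the average of the
  \<open>p\<close>-th absolute powers of \<open>n\<close> standard normal variables, so its mean is \<open>m\<close>. The ratio of the power
  variations equals \<open>real L powr (1 - p * H) * (S (L * n) / S n)\<close>, hence the error of the estimator is
  \<open>(ln (S n) - ln (S (L * n))) / (p * ln (real L))\<close>. If \<open>S n - m\<close> is of order
  \<open>1 / sqrt n\<close> in mean square, this error is of the same order in probability, since the
  logarithm is Lipschitz near \<open>m > 0\<close>, and \<open>sqrt (n / ln n)\<close> times the error tends to 0 by
  Chebyshev's inequality.

  What has to be shown is thus that the variance of \<open>S n\<close> is \<open>O(1 / n)\<close>
  (\<open>mean_power_variance_le\<close>). It is the average of the covariances of
  \<open>\<bar>X j\<bar> powr p\<close> and \<open>\<bar>X k\<bar> powr p\<close> over all pairs of normalized increments. Two facts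
  control it. First, for jointly Gaussian standard normal variables with correlation \<open>\<rho>\<close> this
  covariance is at most a constant times \<open>\<rho>\<^sup>2\<close> (\<open>expectation_abs_powr_product_le\<close>). Second,
  increments at lag \<open>d\<close> have a correlation of order \<open>d powr (2 * H - 2)\<close>, whose square is
  summable exactly in the range \<open>H < 3 / 4\<close> (\<open>summable_fgn_corr_square\<close>).

  The covariance bound rests on the decomposition \<open>Y = \<rho> * X + W\<close> with \<open>W\<close> independent of
  \<open>X\<close>. The sign of \<open>X\<close> can be flipped without changing the joint law, so the first-order
  term in \<open>\<rho>\<close> cancels and an elementary bound on the second difference of
  \<open>\<bar>x\<bar> powr p\<close> suffices (\<open>powr_second_difference_le\<close>). That uncorrelated jointly Gaussian
  variables are independent follows by using the uniqueness theorem for one-dimensional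
  characteristic functions twice (\<open>indep_var_if_char_factorizes\<close>).\<close>

section \<open>Second differences of absolute powers\<close>

lemma powr_diff_le_tangent:
  fixes x y q :: real
  assumes "1 \<le> q" "0 \<le> x" "0 \<le> y"
  shows "y powr q - x powr q \<le> q * (y - x) * y powr (q - 1)"
proof (cases "x = 0 \<or> y = 0")
  case True
  then show ?thesis
  proof
    assume "x = 0"
    then show ?thesis using assms mult_right_mono[of 1 q "y powr q"]
      by (cases "y = 0") (auto simp: powr_diff)
  next
    assume "y = 0" then show ?thesis using assms by auto
  qed
next
  case False
  with assms have xy: "0 < x" "0 < y" by auto
  show ?thesis
  proof (cases x y rule: linorder_cases)
    case less
    have "\<exists>z. x < z \<and> z < y \<and> y powr q - x powr q = (y - x) * (q * z powr (q - 1))"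
      using less xy by (intro MVT2) (auto intro!: derivative_eq_intros simp: powr_diff)
    then obtain z where z: "x < z" "z < y" "y powr q - x powr q = (y - x) * (q * z powr (q - 1))"
      by blast
    have "z powr (q - 1) \<le> y powr (q - 1)" using z xy assms by (intro powr_mono2) auto
    then have "(y - x) * (q * z powr (q - 1)) \<le> (y - x) * (q * y powr (q - 1))"
      using less assms by (intro mult_left_mono) auto
    then show ?thesis using z by (simp add: mult_ac)
  next
    case greater
    have "\<exists>z. y < z \<and> z < x \<and> x powr q - y powr q = (x - y) * (q * z powr (q - 1))"
      using greater xy by (intro MVT2) (auto intro!: derivative_eq_intros simp: powr_diff)
    then obtain z where z: "y < z" "z < x" "x powr q - y powr q = (x - y) * (q * z powr (q - 1))"
      by blast
    have "y powr (q - 1) \<le> z powr (q - 1)" using z xy assms by (intro powr_mono2) auto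
    then have "(x - y) * (q * y powr (q - 1)) \<le> (x - y) * (q * z powr (q - 1))"
      using greater assms by (intro mult_left_mono) auto
    then show ?thesis using z by (simp add: algebra_simps)
  qed simp
qed

text \<open>A quantitative form of ``\<open>\<bar>x\<bar> powr p\<close> has second derivative of order
  \<open>\<bar>x\<bar> powr (p - 2)\<close>'' that also covers intervals containing the singular point 0.
  Writing \<open>\<bar>x\<bar> powr p\<close> as \<open>(x\<^sup>2) powr (p / 2)\<close> and using the tangent inequality for the
  convex function \<open>y powr (p / 2)\<close> at \<open>(a + b)\<^sup>2\<close> and \<open>(a - b)\<^sup>2\<close>, the first-order terms
  \<open>\<plusminus> 2 * a * b\<close> combine into a difference \<open>\<bar>a + b\<bar> powr r - \<bar>a - b\<bar> powr r\<close> with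
  \<open>r = p - 2\<close>. It is of first order in \<open>b\<close> because \<open>r \<ge> 1\<close>; for \<open>p = 2\<close> the inequality
  is the parallelogram identity.\<close>

lemma powr_second_difference_le:
  fixes a b p :: real
  assumes "p = 2 \<or> 3 \<le> p"
  shows "\<bar>a + b\<bar> powr p + \<bar>a - b\<bar> powr p - 2 * \<bar>a\<bar> powr p
           \<le> p * (2 * p - 3) * b\<^sup>2 * (\<bar>a\<bar> + \<bar>b\<bar>) powr (p - 2)"
  using assms
proof
  assume p: "p = 2"
  show ?thesis
  proof (cases "a = 0 \<and> b = 0")
    case False
    then have "(\<bar>a\<bar> + \<bar>b\<bar>) powr (p - 2) = 1" using p by auto
    then show ?thesis using p by (simp add: power2_eq_square algebra_simps)
  qed auto
next
  assume p: "3 \<le> p"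
  define r where "r = p - 2"
  define s where "s = \<bar>a\<bar> + \<bar>b\<bar>"
  have sq: "\<bar>x\<bar> powr q = (x\<^sup>2) powr (q / 2)" if "0 \<le> q" for x q :: real
  proof -
    have "(x\<^sup>2) powr (q / 2) = (\<bar>x\<bar> powr 2) powr (q / 2)" by simp
    then show ?thesis by (simp only: powr_powr) simp
  qed
  \<comment> \<open>The tangent inequality in the variable \<open>x\<^sup>2\<close>.\<close>
  have tan: "\<bar>x\<bar> powr p - \<bar>a\<bar> powr p \<le> p / 2 * (x\<^sup>2 - a\<^sup>2) * \<bar>x\<bar> powr r" for x
    using powr_diff_le_tangent[of "p / 2" "a\<^sup>2" "x\<^sup>2"] p sq[of p] sq[of r]
    by (simp add: r_def diff_divide_distrib)
  have lip: "\<bar>\<bar>a + b\<bar> powr r - \<bar>a - b\<bar> powr r\<bar> \<le> r * (2 * \<bar>b\<bar>) * s powr (r - 1)"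
  proof -
    have *: "y powr r - x powr r \<le> r * (2 * \<bar>b\<bar>) * s powr (r - 1)"
      if "0 \<le> x" "0 \<le> y" "y - x \<le> 2 * \<bar>b\<bar>" "y \<le> s" for x y
    proof -
      have "y powr r - x powr r \<le> r * (y - x) * y powr (r - 1)"
        using that p by (intro powr_diff_le_tangent) (auto simp: r_def)
      also have "\<dots> \<le> r * (2 * \<bar>b\<bar>) * y powr (r - 1)"
        using that p by (intro mult_right_mono mult_left_mono) (auto simp: r_def)
      also have "\<dots> \<le> r * (2 * \<bar>b\<bar>) * s powr (r - 1)"
        using that p by (intro mult_left_mono powr_mono2) (auto simp: r_def)
      finally show ?thesis .
    qed
    show ?thesis
      using *[of "\<bar>a - b\<bar>" "\<bar>a + b\<bar>"] *[of "\<bar>a + b\<bar>" "\<bar>a - b\<bar>"] unfolding s_def by linarith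
  qed
  have up: "\<bar>a + b\<bar> powr r \<le> s powr r" "\<bar>a - b\<bar> powr r \<le> s powr r"
    using p by (auto simp: s_def r_def intro!: powr_mono2)
  have sr: "s * s powr (r - 1) = s powr r"
    by (cases "s = 0") (auto simp: s_def powr_diff)
  have cross: "2 * a * b * (\<bar>a + b\<bar> powr r - \<bar>a - b\<bar> powr r) \<le> 4 * r * b\<^sup>2 * s powr r"
  proof -
    have "2 * a * b * (\<bar>a + b\<bar> powr r - \<bar>a - b\<bar> powr r)
        \<le> \<bar>2 * a * b * (\<bar>a + b\<bar> powr r - \<bar>a - b\<bar> powr r)\<bar>" by (rule abs_ge_self)
    also have "\<dots> = 2 * \<bar>a\<bar> * \<bar>b\<bar> * \<bar>\<bar>a + b\<bar> powr r - \<bar>a - b\<bar> powr r\<bar>" by (simp add: abs_mult)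
    also have "\<dots> \<le> 2 * s * \<bar>b\<bar> * (r * (2 * \<bar>b\<bar>) * s powr (r - 1))"
      using lip by (intro mult_mono) (auto simp: s_def)
    also have "\<dots> = 4 * r * \<bar>b\<bar>\<^sup>2 * (s * s powr (r - 1))" by (simp add: power2_eq_square)
    finally show ?thesis by (simp add: sr)
  qed
  have "\<bar>a + b\<bar> powr p + \<bar>a - b\<bar> powr p - 2 * \<bar>a\<bar> powr p
      \<le> p / 2 * (((a + b)\<^sup>2 - a\<^sup>2) * \<bar>a + b\<bar> powr r + ((a - b)\<^sup>2 - a\<^sup>2) * \<bar>a - b\<bar> powr r)"
    using tan[of "a + b"] tan[of "a - b"] by (simp add: algebra_simps)
  also have "\<dots> = p / 2 * (b\<^sup>2 * (\<bar>a + b\<bar> powr r + \<bar>a - b\<bar> powr r)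
      + 2 * a * b * (\<bar>a + b\<bar> powr r - \<bar>a - b\<bar> powr r))"
    by (simp add: power2_eq_square algebra_simps)
  also have "\<dots> \<le> p / 2 * (b\<^sup>2 * (s powr r + s powr r) + 4 * r * b\<^sup>2 * s powr r)"
    using p up cross by (intro mult_left_mono add_mono) auto
  also have "\<dots> = p * (2 * p - 3) * b\<^sup>2 * s powr (p - 2)"
    by (simp add: r_def algebra_simps)
  finally show ?thesis by (simp add: s_def)
qed

lemma powr_add_le:
  fixes x y q :: real
  assumes "0 \<le> x" "0 \<le> y" "0 \<le> q"
  shows "(x + y) powr q \<le> 2 powr q * (x powr q + y powr q)"
proof -
  have "(x + y) powr q \<le> (2 * max x y) powr q" using assms by (intro powr_mono2) auto
  also have "\<dots> = 2 powr q * (max x y) powr q" using assms by (simp add: powr_mult)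
  also have "\<dots> \<le> 2 powr q * (x powr q + y powr q)"
    by (intro mult_left_mono) (auto simp: max_def)
  finally show ?thesis .
qed

text \<open>The pointwise estimate behind the covariance bound: averaged over the sign of \<open>x\<close>,
  the perturbation \<open>\<rho> * x\<close> of \<open>w\<close> only contributes at order \<open>\<rho>\<^sup>2\<close>. All
  powers in the error term are collected into moments of order \<open>2 * p\<close>.\<close>

lemma symmetrised_product_le:
  fixes x w \<rho> p :: real
  assumes p: "p = 2 \<or> 3 \<le> p" and \<rho>: "\<bar>\<rho>\<bar> \<le> 1"
  shows "\<bar>x\<bar> powr p * \<bar>w + \<rho> * x\<bar> powr p + \<bar>x\<bar> powr p * \<bar>w - \<rho> * x\<bar> powr p
    \<le> 2 * (\<bar>x\<bar> powr p * \<bar>w\<bar> powr p)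
      + p * (2 * p - 3) * 4 powr p * \<rho>\<^sup>2 * (\<bar>x\<bar> powr (2 * p) + \<bar>w\<bar> powr (2 * p))"
proof (cases "x = 0")
  case False
  define s where "s = \<bar>x\<bar> + \<bar>w\<bar>"
  have s: "0 < s" "\<bar>x\<bar> \<le> s" using False by (auto simp: s_def)
  have p2: "2 \<le> p" using p by auto
  define K where "K = p * (2 * p - 3)"
  have K: "0 \<le> K" using p2 by (simp add: K_def)
  have \<rho>x: "\<bar>\<rho> * x\<bar> \<le> \<bar>x\<bar>" using \<rho> by (simp add: abs_mult mult_left_le_one_le)
  have "\<bar>w + \<rho> * x\<bar> powr p + \<bar>w - \<rho> * x\<bar> powr p - 2 * \<bar>w\<bar> powr p
      \<le> K * (\<rho> * x)\<^sup>2 * (\<bar>w\<bar> + \<bar>\<rho> * x\<bar>) powr (p - 2)"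
    unfolding K_def by (rule powr_second_difference_le[OF p])
  also have "\<dots> \<le> K * (\<rho>\<^sup>2 * s\<^sup>2) * s powr (p - 2)"
    using K s p2 \<rho>x
    by (intro mult_mono powr_mono2)
       (auto simp: s_def power_mult_distrib abs_le_square_iff[symmetric] intro!: mult_left_mono)
  also have "\<dots> = K * \<rho>\<^sup>2 * (s powr 2 * s powr (p - 2))" using s by simp
  also have "\<dots> = K * \<rho>\<^sup>2 * s powr p" by (simp only: powr_add[symmetric]) simp
  finally have d: "\<bar>w + \<rho> * x\<bar> powr p + \<bar>w - \<rho> * x\<bar> powr p - 2 * \<bar>w\<bar> powr p
      \<le> K * \<rho>\<^sup>2 * s powr p" .
  have "\<bar>x\<bar> powr p * (\<bar>w + \<rho> * x\<bar> powr p + \<bar>w - \<rho> * x\<bar> powr p - 2 * \<bar>w\<bar> powr p)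
      \<le> s powr p * (K * \<rho>\<^sup>2 * s powr p)"
    (is "?a * ?d \<le> ?b * ?e")
  proof -
    have "?a * ?d \<le> ?a * ?e" using d by (intro mult_left_mono) auto
    also have "\<dots> \<le> ?b * ?e" using K s p2 by (intro mult_right_mono powr_mono2) auto
    finally show ?thesis .
  qed
  also have "\<dots> = K * \<rho>\<^sup>2 * s powr (2 * p)" by (simp add: powr_add[symmetric])
  also have "\<dots> \<le> K * \<rho>\<^sup>2 * (2 powr (2 * p) * (\<bar>x\<bar> powr (2 * p) + \<bar>w\<bar> powr (2 * p)))"
    using K p2 unfolding s_def by (intro mult_left_mono powr_add_le) auto
  also have "2 powr (2 * p) = (4 powr p :: real)" by (simp add: powr_powr[symmetric])
  finally show ?thesis by (simp add: K_def algebra_simps)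
qed (use p in auto)

section \<open>Centered Gaussian variables\<close>

definition normal_abs_moment :: "real \<Rightarrow> real" where
  "normal_abs_moment q = (LINT z|std_normal_distribution. \<bar>z\<bar> powr q)"

lemma integrable_abs_powr_std_normal:
  fixes q :: real
  assumes q: "0 \<le> q"
  shows "integrable std_normal_distribution (\<lambda>z. \<bar>z\<bar> powr q)"
proof (rule Bochner_Integration.integrable_bound)
  let ?k = "nat \<lceil>q\<rceil>"
  show "integrable std_normal_distribution (\<lambda>z::real. 1 + \<bar>z ^ ?k\<bar>)"
    using integrable_std_normal_distribution_moment[of 0] integrable_std_normal_distribution_moment[of ?k]
    by (intro Bochner_Integration.integrable_add integrable_abs) auto
  show "AE z in std_normal_distribution. norm (\<bar>z\<bar> powr q) \<le> norm (1 + \<bar>z ^ ?k\<bar>)"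
  proof (rule AE_I2)
    fix z :: real
    have "\<bar>z\<bar> powr q \<le> 1 + \<bar>z ^ ?k\<bar>"
    proof (cases "\<bar>z\<bar> \<le> 1")
      case True
      then have "\<bar>z\<bar> powr q \<le> 1" using q by (intro powr_le1) auto
      then show ?thesis by (smt (verit) abs_ge_zero)
    next
      case False
      then have "\<bar>z\<bar> powr q \<le> \<bar>z\<bar> powr real ?k" by (intro powr_mono) (use q in linarith)+
      then show ?thesis using False by (simp add: powr_realpow power_abs)
    qed
    then show "norm (\<bar>z\<bar> powr q) \<le> norm (1 + \<bar>z ^ ?k\<bar>)" by simp
  qed
qed simp

lemma normal_abs_moment_pos:
  assumes "0 \<le> q"
  shows "0 < normal_abs_moment q"
proof -
  have "0 \<le> normal_abs_moment q" unfolding normal_abs_moment_def by (rule integral_nonneg_AE) simp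
  moreover have "normal_abs_moment q \<noteq> 0"
  proof
    assume "normal_abs_moment q = 0"
    then have "AE z in std_normal_distribution. \<bar>z\<bar> powr q = 0"
      unfolding normal_abs_moment_def
      using integral_nonneg_eq_0_iff_AE[OF integrable_abs_powr_std_normal[OF assms]] by simp
    then have "AE z in lborel. z = (0::real)"
      by (subst (asm) AE_density) (auto simp: normal_density_pos)
    moreover have "AE z in lborel. z \<noteq> (0::real)" by (rule AE_lborel_singleton)
    ultimately have "AE z in (lborel::real measure). False" by eventually_elim simp
    then show False by (simp add: AE_iff_measurable[of "UNIV::real set"])
  qed
  ultimately show ?thesis by linarith
qed

context prob_space
begin

text \<open>Scaling a standard normal variable by the standard deviation treats the nondegenerate
  and the degenerate case at once: for variance 0 the image law is the point mass at 0. Everything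
  below about single Gaussian variables is read off from this identity.\<close>

lemma centered_gaussian_distr:
  assumes "gaussian_rv M X" "expectation X = 0"
  shows "distr M borel X
    = distr std_normal_distribution borel (\<lambda>z. sqrt (expectation (\<lambda>\<omega>. (X \<omega>)\<^sup>2)) * z)"
proof -
  have [measurable]: "X \<in> borel_measurable M" using assms by (simp add: gaussian_rv_def)
  from assms(1) consider \<mu> \<sigma> where "0 < \<sigma>" "distributed M lborel X (normal_density \<mu> \<sigma>)"
    | \<mu> where "AE \<omega> in M. X \<omega> = \<mu>" by (auto simp: gaussian_rv_def)
  then show ?thesis
  proof cases
    case (1 \<mu> \<sigma>)
    then have [simp]: "\<mu> = 0" using normal_distributed_expectation assms(2) by blast
    have v: "expectation (\<lambda>\<omega>. (X \<omega>)\<^sup>2) = \<sigma>\<^sup>2"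
      using normal_distributed_variance[OF 1] assms(2) by simp
    have "distributed M lborel (\<lambda>\<omega>. X \<omega> / \<sigma>) std_normal_density"
      using 1 normal_standard_normal_convert[of \<sigma> X \<mu>] by simp
    then have *: "distr M lborel (\<lambda>\<omega>. X \<omega> / \<sigma>) = std_normal_distribution"
      by (simp add: distributed_def)
    have "distr std_normal_distribution borel (\<lambda>z. \<sigma> * z) = distr M borel X"
      unfolding *[symmetric] using 1 by (subst distr_distr) (auto simp: comp_def)
    then show ?thesis using 1 v by simp
  next
    case (2 \<mu>)
    have "expectation X = \<mu>" using 2 by (subst integral_cong_AE[of _ _ "\<lambda>_. \<mu>"]) (auto simp: prob_space)
    then have X0: "AE \<omega> in M. X \<omega> = 0" using 2 assms by simp
    have v: "expectation (\<lambda>\<omega>. (X \<omega>)\<^sup>2) = 0"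
      using X0 by (subst integral_cong_AE[of _ _ "\<lambda>_. 0"]) auto
    interpret N: prob_space std_normal_distribution by (rule prob_space_normal_density) simp
    have "distr M borel X = distr M borel (\<lambda>_. 0)" using X0 by (intro distr_cong_AE) auto
    also have "\<dots> = return borel 0" by (rule distr_const) simp
    also have "\<dots> = distr std_normal_distribution borel (\<lambda>z. 0)"
      by (rule N.distr_const[symmetric]) simp
    finally show ?thesis using v by simp
  qed
qed

lemma centered_gaussian_integral:
  fixes f :: "real \<Rightarrow> 'b :: {banach, second_countable_topology}"
  assumes "gaussian_rv M X" "expectation X = 0" "f \<in> borel_measurable borel"
  defines "\<sigma> \<equiv> sqrt (expectation (\<lambda>\<omega>. (X \<omega>)\<^sup>2))"
  shows "(LINT \<omega>|M. f (X \<omega>)) = (LINT z|std_normal_distribution. f (\<sigma> * z))"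
    and "integrable M (\<lambda>\<omega>. f (X \<omega>)) \<longleftrightarrow> integrable std_normal_distribution (\<lambda>z. f (\<sigma> * z))"
proof -
  have [measurable]: "X \<in> borel_measurable M" using assms by (simp add: gaussian_rv_def)
  note d = centered_gaussian_distr[OF assms(1,2), folded \<sigma>_def]
  show "(LINT \<omega>|M. f (X \<omega>)) = (LINT z|std_normal_distribution. f (\<sigma> * z))"
    using arg_cong[OF d, of "\<lambda>D. LINT x|D. f x"] assms(3) by (simp add: integral_distr)
  show "integrable M (\<lambda>\<omega>. f (X \<omega>)) \<longleftrightarrow> integrable std_normal_distribution (\<lambda>z. f (\<sigma> * z))"
    using arg_cong[OF d, of "\<lambda>D. integrable D f"] assms(3) by (simp add: integrable_distr_eq)
qed

lemma centered_gaussian_abs_moment: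
  assumes X: "gaussian_rv M X" "expectation X = 0" and q: "0 \<le> q"
  shows "integrable M (\<lambda>\<omega>. \<bar>X \<omega>\<bar> powr q)"
    and "expectation (\<lambda>\<omega>. \<bar>X \<omega>\<bar> powr q)
      = sqrt (expectation (\<lambda>\<omega>. (X \<omega>)\<^sup>2)) powr q * normal_abs_moment q"
proof -
  let ?s = "sqrt (expectation (\<lambda>\<omega>. (X \<omega>)\<^sup>2))"
  have s: "0 \<le> ?s" by (simp add: integral_nonneg_AE)
  have *: "\<bar>?s * z\<bar> powr q = ?s powr q * \<bar>z\<bar> powr q" for z
    using s by (simp add: abs_mult powr_mult)
  show "integrable M (\<lambda>\<omega>. \<bar>X \<omega>\<bar> powr q)"
    using integrable_abs_powr_std_normal[OF q]
    by (subst centered_gaussian_integral(2)[OF X, of "\<lambda>x. \<bar>x\<bar> powr q"]) (auto simp: *)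
  show "expectation (\<lambda>\<omega>. \<bar>X \<omega>\<bar> powr q) = ?s powr q * normal_abs_moment q"
    by (subst centered_gaussian_integral(1)[OF X, of "\<lambda>x. \<bar>x\<bar> powr q"])
       (auto simp: * normal_abs_moment_def)
qed

lemma centered_gaussian_square_integrable:
  assumes "gaussian_rv M X" "expectation X = 0"
  shows "integrable M (\<lambda>\<omega>. (X \<omega>)\<^sup>2)"
  using centered_gaussian_abs_moment(1)[OF assms, of 2] by simp

lemma centered_gaussian_char:
  assumes X: "gaussian_rv M X" "expectation X = 0"
  shows "(CLINT \<omega>|M. iexp (X \<omega>)) = complex_of_real (exp (- expectation (\<lambda>\<omega>. (X \<omega>)\<^sup>2) / 2))"
proof -
  let ?v = "expectation (\<lambda>\<omega>. (X \<omega>)\<^sup>2)"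
  have v: "0 \<le> ?v" by (simp add: integral_nonneg_AE)
  have "(CLINT \<omega>|M. iexp (X \<omega>)) = (CLINT z|std_normal_distribution. iexp (sqrt ?v * z))"
    by (rule centered_gaussian_integral(1)[OF X, of iexp]) measurable
  also have "\<dots> = char std_normal_distribution (sqrt ?v)" by (simp add: char_def)
  also have "\<dots> = complex_of_real (exp (- ?v / 2))" using v by (simp add: char_std_normal_distribution)
  finally show ?thesis .
qed

end

section \<open>Independence from characteristic functions\<close>

context prob_space
begin

text \<open>Uniqueness of characteristic functions, applied to the law of \<open>X\<close> under the tilted
  probability measure with density \<open>w\<close> divided by its mean: if the weight does not affect the
  Fourier transform of \<open>X\<close>, it does not affect the probabilities of \<open>X\<close> either.\<close>

lemma weighted_law_eq:
  fixes w X :: "'a \<Rightarrow> real"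
  assumes [measurable]: "w \<in> borel_measurable M" "X \<in> borel_measurable M"
    and w: "\<And>\<omega>. 0 \<le> w \<omega>" "integrable M w" "0 < expectation w"
    and eq: "\<And>s. (CLINT \<omega>|M. w \<omega> * iexp (s * X \<omega>)) = expectation w * (CLINT \<omega>|M. iexp (s * X \<omega>))"
    and [measurable]: "A \<in> sets borel"
  shows "expectation (\<lambda>\<omega>. w \<omega> * indicator A (X \<omega>))
    = expectation w * expectation (\<lambda>\<omega>. indicator A (X \<omega>))"
proof -
  define c where "c = expectation w"
  define N where "N = density M (\<lambda>\<omega>. ennreal (w \<omega> / c))"
  have c: "0 < c" using w by (simp add: c_def)
  have intN: "integral\<^sup>L N f = (LINT \<omega>|M. (w \<omega> / c) *\<^sub>R f \<omega>)"
    if "f \<in> borel_measurable M" for f :: "'a \<Rightarrow> 'b::{banach,second_countable_topology}"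
    unfolding N_def using that w c by (subst integral_density) auto
  have [simp]: "sets N = sets M" "space N = space M" by (simp_all add: N_def)
  have [measurable]: "X \<in> borel_measurable N" by (simp add: N_def)
  interpret N: prob_space N
  proof
    have "emeasure N (space N) = (\<integral>\<^sup>+ \<omega>. ennreal (w \<omega> / c) \<partial>M)"
      unfolding N_def by (subst emeasure_density) (auto intro!: nn_integral_cong)
    also have "\<dots> = ennreal (LINT \<omega>|M. w \<omega> / c)"
      using w c by (intro nn_integral_eq_integral) auto
    also have "\<dots> = 1" using c by (simp add: c_def)
    finally show "emeasure N (space N) = 1" .
  qed
  have "char (distr N borel X) = char (distr M borel X)"
  proof
    fix s
    have "char (distr N borel X) s = (CLINT \<omega>|M. (w \<omega> / c) *\<^sub>R iexp (s * X \<omega>))"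
      by (simp add: char_def integral_distr intN)
    also have "\<dots> = (CLINT \<omega>|M. (w \<omega> * iexp (s * X \<omega>)) / c)"
      by (simp add: scaleR_conv_of_real)
    also have "\<dots> = (CLINT \<omega>|M. w \<omega> * iexp (s * X \<omega>)) / c" by (rule integral_divide_zero)
    also have "\<dots> = char (distr M borel X) s"
      using c eq[of s] by (simp add: c_def[symmetric] char_def integral_distr)
    finally show "char (distr N borel X) s = char (distr M borel X) s" .
  qed
  then have "distr N borel X = distr M borel X"
    by (intro Levy_uniqueness N.real_distribution_distr real_distribution_distr) auto
  then have "(LINT x|distr N borel X. indicator A x :: real) = (LINT x|distr M borel X. indicator A x)"
    by simp
  then have "(LINT \<omega>|N. indicator A (X \<omega>) :: real) = (LINT \<omega>|M. indicator A (X \<omega>))"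
    by (subst (asm) (1 2) integral_distr) simp_all
  moreover have "(LINT \<omega>|N. indicator A (X \<omega>) :: real) = (LINT \<omega>|M. w \<omega> * indicator A (X \<omega>) / c)"
    by (subst intN) simp_all
  ultimately have "expectation (\<lambda>\<omega>. w \<omega> * indicator A (X \<omega>)) / c = expectation (\<lambda>\<omega>. indicator A (X \<omega>))"
    by simp
  then show ?thesis using c by (simp add: c_def[symmetric] field_simps)
qed

text \<open>A factorizing joint characteristic function implies independence, here derived from
  one-dimensional uniqueness alone. Fix \<open>t\<close>. The bounded waves \<open>cos (t * W)\<close> and \<open>sin (t * W)\<close>,
  shifted to be positive, are weights that do not affect the Fourier transform of \<open>X\<close>, so
  they are uncorrelated with every indicator of \<open>X\<close>. This says in turn that an
  indicator of \<open>X\<close> is a weight that does not affect the Fourier transform of \<open>W\<close>, so it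
  is uncorrelated with every indicator of \<open>W\<close>.\<close>

lemma indep_var_if_char_factorizes:
  fixes X W :: "'a \<Rightarrow> real"
  assumes [measurable]: "X \<in> borel_measurable M" "W \<in> borel_measurable M"
    and eq: "\<And>s t. (CLINT \<omega>|M. iexp (s * X \<omega> + t * W \<omega>))
      = (CLINT \<omega>|M. iexp (s * X \<omega>)) * (CLINT \<omega>|M. iexp (t * W \<omega>))"
  shows "indep_var borel X borel W"
proof -
  have int[simp]: "integrable M (\<lambda>\<omega>. iexp (f \<omega>))" if "f \<in> borel_measurable M" for f :: "'a \<Rightarrow> real"
    using that by (intro integrable_const_bound[of _ 1]) auto
  \<comment> \<open>The factor \<open>c\<close> selects the cosine (\<open>c = 1\<close>) or the sine (\<open>c = - \<i>\<close>); the
    summand 2 makes the weight at least 1.\<close>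
  have wave: "expectation (\<lambda>\<omega>. (2 + Re (c * iexp (t * W \<omega>))) * indicator A (X \<omega>))
      = expectation (\<lambda>\<omega>. 2 + Re (c * iexp (t * W \<omega>))) * expectation (\<lambda>\<omega>. indicator A (X \<omega>))"
    if c: "norm c = 1" and [measurable]: "A \<in> sets borel" for c t A
  proof (rule weighted_law_eq)
    have Re1: "\<bar>Re (c * iexp (t * x))\<bar> \<le> 1" for x
      using abs_Re_le_cmod[of "c * iexp (t * x)"] c by (simp add: norm_mult)
    have [measurable]: "(\<lambda>\<omega>. Re (c * iexp (t * W \<omega>))) \<in> borel_measurable M" by measurable
    show "0 \<le> 2 + Re (c * iexp (t * W \<omega>))" for \<omega> using Re1[of "W \<omega>"] by linarith
    have intRe: "integrable M (\<lambda>\<omega>. Re (c * iexp (t * W \<omega>)))"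
      by (intro integrable_Re integrable_mult_right int) measurable
    then show i2: "integrable M (\<lambda>\<omega>. 2 + Re (c * iexp (t * W \<omega>)))" by simp
    have "expectation (\<lambda>\<omega>. 1) \<le> expectation (\<lambda>\<omega>. 2 + Re (c * iexp (t * W \<omega>)))"
    proof (rule integral_mono)
      show "1 \<le> 2 + Re (c * iexp (t * W \<omega>))" for \<omega> using Re1[of "W \<omega>"] by linarith
    qed (use i2 in auto)
    then show "0 < expectation (\<lambda>\<omega>. 2 + Re (c * iexp (t * W \<omega>)))" by (simp add: prob_space)
    fix s
    have Re2: "complex_of_real (2 + Re (c * iexp (t * x)))
        = 2 + (c * iexp (t * x) + cnj c * iexp (- t * x)) / 2" for x
    proof -
      have "cnj (c * iexp (t * x)) = cnj c * iexp (- t * x)" by (simp add: exp_cnj)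
      moreover have "complex_of_real (2 + Re z) = 2 + (z + cnj z) / 2" for z
        by (simp only: complex_add_cnj) simp
      ultimately show ?thesis by metis
    qed
    have split: "iexp (s * x + r * w) = iexp (s * x) * iexp (r * w)" for r x w
      by (simp add: exp_add distrib_left)
    have dist: "(2 + (c * b + d * b') / 2) * a = 2 * a + (c / 2 * (a * b) + d / 2 * (a * b'))"
      for a b b' c d :: complex by (simp add: field_simps)
    have ex: "complex_of_real (2 + Re (c * iexp (t * w))) * iexp (s * x)
       = 2 * iexp (s * x) + (c / 2 * iexp (s * x + t * w) + cnj c / 2 * iexp (s * x + (- t) * w))" for x w
      unfolding Re2 split by (rule dist)
    have ex0: "complex_of_real (2 + Re (c * iexp (t * w)))
       = 2 + (c / 2 * iexp (t * w) + cnj c / 2 * iexp ((- t) * w))" for w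
      unfolding Re2 by (simp only: add_divide_distrib times_divide_eq_left)
    have lin: "(CLINT \<omega>|M. 2 * F \<omega> + (a * G \<omega> + b * K \<omega>)) = 2 * (CLINT \<omega>|M. F \<omega>)
        + (a * (CLINT \<omega>|M. G \<omega>) + b * (CLINT \<omega>|M. K \<omega>))"
      if "integrable M F" "integrable M G" "integrable M K" for F G K a b
      using that by simp
    have iW: "integrable M (\<lambda>\<omega>. iexp (r * W \<omega>))" for r by (intro int) measurable
    let ?E = "\<lambda>f. CLINT \<omega>|M. iexp (f \<omega>)"
    have "(CLINT \<omega>|M. complex_of_real (2 + Re (c * iexp (t * W \<omega>))) * iexp (s * X \<omega>))
      = 2 * ?E (\<lambda>\<omega>. s * X \<omega>) + (c / 2 * ?E (\<lambda>\<omega>. s * X \<omega> + t * W \<omega>)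
        + cnj c / 2 * ?E (\<lambda>\<omega>. s * X \<omega> + (- t) * W \<omega>))"
      unfolding ex by (rule lin; intro int; measurable)
    also have "\<dots> = (2 + (c / 2 * ?E (\<lambda>\<omega>. t * W \<omega>) + cnj c / 2 * ?E (\<lambda>\<omega>. (- t) * W \<omega>)))
        * ?E (\<lambda>\<omega>. s * X \<omega>)"
      unfolding eq by (simp add: algebra_simps)
    also have "2 + (c / 2 * ?E (\<lambda>\<omega>. t * W \<omega>) + cnj c / 2 * ?E (\<lambda>\<omega>. (- t) * W \<omega>))
      = (CLINT \<omega>|M. complex_of_real (2 + Re (c * iexp (t * W \<omega>))))"
      unfolding ex0 using lin[OF _ iW[of t] iW[of "- t"], of "\<lambda>_. 1" "c / 2" "cnj c / 2"]
      by (simp only: mult_1_right) (simp add: prob_space)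
    also have "\<dots> = complex_of_real (expectation (\<lambda>\<omega>. 2 + Re (c * iexp (t * W \<omega>))))"
      by (rule integral_complex_of_real)
    finally show "(CLINT \<omega>|M. complex_of_real (2 + Re (c * iexp (t * W \<omega>))) * iexp (s * X \<omega>))
      = complex_of_real (expectation (\<lambda>\<omega>. 2 + Re (c * iexp (t * W \<omega>)))) * ?E (\<lambda>\<omega>. s * X \<omega>)" .
  qed measurable
  have intA: "integrable M (\<lambda>\<omega>. z \<omega> * indicator A (X \<omega>))"
    if "integrable M z" "A \<in> sets borel" for z :: "'a \<Rightarrow> 'b :: {banach, second_countable_topology, real_normed_algebra_1}" and A
  proof (rule Bochner_Integration.integrable_bound[OF that(1)])
    have [measurable]: "z \<in> borel_measurable M" using that by auto
    show "(\<lambda>\<omega>. z \<omega> * indicator A (X \<omega>)) \<in> borel_measurable M" using that(2) by measurable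
    show "AE \<omega> in M. norm (z \<omega> * indicator A (X \<omega>)) \<le> norm (z \<omega>)"
      by (intro AE_I2) (auto simp: indicator_def)
  qed
  have wave': "expectation (\<lambda>\<omega>. Re (c * iexp (t * W \<omega>)) * indicator A (X \<omega>))
      = expectation (\<lambda>\<omega>. Re (c * iexp (t * W \<omega>))) * expectation (\<lambda>\<omega>. indicator A (X \<omega>))"
    if c: "norm c = 1" and [measurable]: "A \<in> sets borel" for c t A
  proof -
    have i: "integrable M (\<lambda>\<omega>. Re (c * iexp (t * W \<omega>)))"
      by (intro integrable_Re integrable_mult_right int) measurable
    have "integrable M (\<lambda>\<omega>. 1 * indicator A (X \<omega>) :: real)" by (intro intA) auto
    then show ?thesis
      using wave[OF c, of A t] i intA[OF i, of A] by (simp add: distrib_right prob_space del: times_complex.sel)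
  qed
  have main: "(CLINT \<omega>|M. indicator A (X \<omega>) * iexp (t * W \<omega>))
      = complex_of_real (expectation (\<lambda>\<omega>. indicator A (X \<omega>))) * (CLINT \<omega>|M. iexp (t * W \<omega>))"
    if [measurable]: "A \<in> sets borel" for t A
  proof -
    have i: "integrable M (\<lambda>\<omega>. iexp (t * W \<omega>))" by (intro int) measurable
    note iA = intA[OF i, of A]
    have part: "Re (c * (CLINT \<omega>|M. iexp (t * W \<omega>) * indicator A (X \<omega>)))
        = Re (c * (complex_of_real (expectation (\<lambda>\<omega>. indicator A (X \<omega>))) * (CLINT \<omega>|M. iexp (t * W \<omega>))))"
      if c: "norm c = 1" for c
    proof -
      have "Re (c * (CLINT \<omega>|M. iexp (t * W \<omega>) * indicator A (X \<omega>)))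
        = expectation (\<lambda>\<omega>. Re (c * (iexp (t * W \<omega>) * indicator A (X \<omega>))))"
        using iA by (simp only: integral_mult_right_zero[symmetric] integral_Re[symmetric] integrable_mult_right that \<open>A \<in> sets borel\<close>)
      also have "\<dots> = expectation (\<lambda>\<omega>. Re (c * iexp (t * W \<omega>)) * indicator A (X \<omega>))"
        by (intro Bochner_Integration.integral_cong) (auto simp: indicator_def)
      also have "\<dots> = expectation (\<lambda>\<omega>. Re (c * iexp (t * W \<omega>))) * expectation (\<lambda>\<omega>. indicator A (X \<omega>))"
        by (rule wave'[OF c]) fact
      also have "expectation (\<lambda>\<omega>. Re (c * iexp (t * W \<omega>))) = Re (c * (CLINT \<omega>|M. iexp (t * W \<omega>)))"
        using i by (simp only: integral_mult_right_zero[symmetric] integral_Re[symmetric] integrable_mult_right)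
      finally show ?thesis by (simp add: algebra_simps)
    qed
    show ?thesis
      using part[of 1] part[of "- \<i>"] by (intro complex_eqI) (simp_all add: mult.commute)
  qed
  have prod: "prob (X -` A \<inter> space M \<inter> (W -` C \<inter> space M)) = prob (X -` A \<inter> space M) * prob (W -` C \<inter> space M)"
    if [measurable]: "A \<in> sets borel" "C \<in> sets borel" for A C
  proof -
    have ind: "expectation (\<lambda>\<omega>. indicator A (X \<omega>)) = prob (X -` A \<inter> space M)"
      for A :: "real set" and X :: "'a \<Rightarrow> real"
    proof -
      have "(\<lambda>\<omega>. indicator A (X \<omega>) :: real) = indicator (X -` A)" by (auto simp: indicator_def)
      then show ?thesis by simp
    qed
    show ?thesis
    proof (cases "prob (X -` A \<inter> space M) = 0")
      case True
      have "prob (X -` A \<inter> space M \<inter> (W -` C \<inter> space M)) \<le> prob (X -` A \<inter> space M)"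
        by (intro finite_measure_mono) auto
      then show ?thesis using True by (simp add: measure_le_0_iff)
    next
      case False
      then have pos: "0 < expectation (\<lambda>\<omega>. indicator A (X \<omega>) :: real)"
        using ind[of A X] by (simp add: zero_less_measure_iff)
      have "integrable M (\<lambda>\<omega>. 1 * indicator A (X \<omega>) :: real)" by (intro intA) auto
      then have "expectation (\<lambda>\<omega>. indicator A (X \<omega>) * indicator C (W \<omega>) :: real)
        = expectation (\<lambda>\<omega>. indicator A (X \<omega>)) * expectation (\<lambda>\<omega>. indicator C (W \<omega>))"
        using pos main[of A] by (intro weighted_law_eq) (simp_all add: of_real_indicator)
      moreover have "(\<lambda>\<omega>. indicator A (X \<omega>) * indicator C (W \<omega>) :: real)
          = indicator (X -` A \<inter> W -` C)"
        by (auto simp: indicator_def)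
      moreover have "X -` A \<inter> W -` C \<inter> space M = X -` A \<inter> space M \<inter> (W -` C \<inter> space M)" by auto
      ultimately show ?thesis by (simp add: ind)
    qed
  qed
  have stable: "Int_stable {Z -` A \<inter> space M |A. A \<in> sets borel}" for Z :: "'a \<Rightarrow> real"
  proof (safe intro!: Int_stableI)
    fix A C :: "real set" assume "A \<in> sets borel" "C \<in> sets borel"
    then show "\<exists>Aa. Z -` A \<inter> space M \<inter> (Z -` C \<inter> space M) = Z -` Aa \<inter> space M \<and> Aa \<in> sets borel"
      by (intro exI[of _ "A \<inter> C"]) auto
  qed
  have "indep_set {X -` A \<inter> space M |A. A \<in> sets borel} {W -` A \<inter> space M |A. A \<in> sets borel}"
    by (rule indep_setI) (auto simp: prod)
  from indep_set_sigma_sets[OF this stable stable] show ?thesis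
    unfolding indep_var_eq using assms(1,2) by blast
qed

end

section \<open>Absolute powers of correlated Gaussian variables\<close>

lemma (in prob_space) integrable_mult_if_square_integrable:
  fixes X Y :: "'a \<Rightarrow> real"
  assumes [measurable]: "X \<in> borel_measurable M" "Y \<in> borel_measurable M"
    and "integrable M (\<lambda>\<omega>. (X \<omega>)\<^sup>2)" "integrable M (\<lambda>\<omega>. (Y \<omega>)\<^sup>2)"
  shows "integrable M (\<lambda>\<omega>. X \<omega> * Y \<omega>)"
proof (rule Bochner_Integration.integrable_bound)
  show "integrable M (\<lambda>\<omega>. (X \<omega>)\<^sup>2 + (Y \<omega>)\<^sup>2)" using assms by simp
  have "\<bar>x * y\<bar> \<le> x\<^sup>2 + y\<^sup>2" for x y :: real
  proof -
    have "0 \<le> (\<bar>x\<bar> - \<bar>y\<bar>)\<^sup>2" by simp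
    then have "2 * \<bar>x * y\<bar> \<le> x\<^sup>2 + y\<^sup>2" by (simp add: power2_diff abs_mult)
    then show ?thesis using abs_ge_zero[of "x * y"] by linarith
  qed
  then show "AE \<omega> in M. norm (X \<omega> * Y \<omega>) \<le> norm ((X \<omega>)\<^sup>2 + (Y \<omega>)\<^sup>2)"
    by (intro AE_I2) (simp add: abs_of_nonneg)
qed simp

context prob_space
begin

text \<open>If the variances of \<open>s * X + t * W\<close> have no mixed term, neither has the
  exponent of the joint characteristic function, which therefore factorizes.\<close>

lemma uncorrelated_gaussian_indep:
  assumes lin: "\<And>s t. gaussian_rv M (\<lambda>\<omega>. s * X \<omega> + t * W \<omega>)"
    and mean: "expectation X = 0" "expectation W = 0"
    and uncorr: "expectation (\<lambda>\<omega>. X \<omega> * W \<omega>) = 0"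
  shows "indep_var borel X borel W"
proof (rule indep_var_if_char_factorizes)
  have X: "gaussian_rv M X" using lin[of 1 0] by simp
  have W: "gaussian_rv M W" using lin[of 0 1] by simp
  show mX[measurable]: "X \<in> borel_measurable M" and mW[measurable]: "W \<in> borel_measurable M"
    using X W by (simp_all add: gaussian_rv_def)
  have iX2: "integrable M (\<lambda>\<omega>. (X \<omega>)\<^sup>2)" and iW2: "integrable M (\<lambda>\<omega>. (W \<omega>)\<^sup>2)"
    using X W mean by (simp_all add: centered_gaussian_square_integrable)
  have iX: "integrable M X" and iW: "integrable M W"
    using square_integrable_imp_integrable iX2 iW2 mX mW by blast+
  have iXW: "integrable M (\<lambda>\<omega>. X \<omega> * W \<omega>)"
    by (rule integrable_mult_if_square_integrable[OF mX mW iX2 iW2])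
  have v: "expectation (\<lambda>\<omega>. (s * X \<omega> + t * W \<omega>)\<^sup>2)
      = s\<^sup>2 * expectation (\<lambda>\<omega>. (X \<omega>)\<^sup>2) + t\<^sup>2 * expectation (\<lambda>\<omega>. (W \<omega>)\<^sup>2)" for s t
  proof -
    have "(s * X \<omega> + t * W \<omega>)\<^sup>2 = s\<^sup>2 * (X \<omega>)\<^sup>2 + t\<^sup>2 * (W \<omega>)\<^sup>2 + (2 * s * t) * (X \<omega> * W \<omega>)" for \<omega>
      by (simp add: power2_eq_square algebra_simps)
    then show ?thesis using iX2 iW2 iXW uncorr by simp
  qed
  have m: "expectation (\<lambda>\<omega>. s * X \<omega> + t * W \<omega>) = 0" for s t
    using iX iW mean by simp
  let ?h = "\<lambda>s t. exp (- (s\<^sup>2 * expectation (\<lambda>\<omega>. (X \<omega>)\<^sup>2) + t\<^sup>2 * expectation (\<lambda>\<omega>. (W \<omega>)\<^sup>2)) / 2)"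
  have ch: "(CLINT \<omega>|M. iexp (s * X \<omega> + t * W \<omega>)) = complex_of_real (?h s t)" for s t
    using centered_gaussian_char[OF lin m] by (simp only: v)
  have h: "?h s t = ?h s 0 * ?h 0 t" for s t
    by (simp add: exp_add[symmetric] add_divide_distrib diff_divide_distrib)
  show "(CLINT \<omega>|M. iexp (s * X \<omega> + t * W \<omega>))
      = (CLINT \<omega>|M. iexp (s * X \<omega>)) * (CLINT \<omega>|M. iexp (t * W \<omega>))" for s t
  proof -
    have "(CLINT \<omega>|M. iexp (s * X \<omega> + t * W \<omega>))
      = (CLINT \<omega>|M. iexp (s * X \<omega> + 0 * W \<omega>)) * (CLINT \<omega>|M. iexp (0 * X \<omega> + t * W \<omega>))"
      unfolding ch of_real_mult[symmetric] by (subst h) (rule refl)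
    then show ?thesis by simp
  qed
qed

text \<open>The covariance of \<open>\<bar>X\<bar> powr p\<close> and \<open>\<bar>Y\<bar> powr p\<close> is of second order in the
  correlation \<open>\<rho>\<close>. The residual \<open>W = Y - \<rho> * X\<close> of the linear regression is
  uncorrelated with \<open>X\<close>, hence independent of it, and \<open>(X, W)\<close> has the same law as
  \<open>(- X, W)\<close>. So \<open>Y = W + \<rho> * X\<close> may be replaced by \<open>W - \<rho> * X\<close>, and averaging both
  versions cancels the term of first order in \<open>\<rho>\<close>. The term of order zero is a
  product of moments, and \<open>W\<close> has variance at most 1.\<close>

lemma expectation_abs_powr_product_le:
  fixes X Y :: "'a \<Rightarrow> real" and p :: real
  assumes lin: "\<And>s t. gaussian_rv M (\<lambda>\<omega>. s * X \<omega> + t * Y \<omega>)"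
    and mean: "expectation X = 0" "expectation Y = 0"
    and var: "expectation (\<lambda>\<omega>. (X \<omega>)\<^sup>2) = 1" "expectation (\<lambda>\<omega>. (Y \<omega>)\<^sup>2) = 1"
    and p: "p = 2 \<or> 3 \<le> p"
  shows "expectation (\<lambda>\<omega>. \<bar>X \<omega>\<bar> powr p * \<bar>Y \<omega>\<bar> powr p) \<le> (normal_abs_moment p)\<^sup>2
    + p * (2 * p - 3) * 4 powr p * normal_abs_moment (2 * p) * (expectation (\<lambda>\<omega>. X \<omega> * Y \<omega>))\<^sup>2"
proof -
  define \<rho> where "\<rho> = expectation (\<lambda>\<omega>. X \<omega> * Y \<omega>)"
  define W where "W = (\<lambda>\<omega>. Y \<omega> - \<rho> * X \<omega>)"
  define K where "K = p * (2 * p - 3) * 4 powr p"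
  have p2: "2 \<le> p" and K: "0 \<le> K" using p by (auto simp: K_def)
  have X: "gaussian_rv M X" using lin[of 1 0] by simp
  have Y: "gaussian_rv M Y" using lin[of 0 1] by simp
  have mX[measurable]: "X \<in> borel_measurable M" and mY[measurable]: "Y \<in> borel_measurable M"
    using X Y by (simp_all add: gaussian_rv_def)
  have mW[measurable]: "W \<in> borel_measurable M" by (simp add: W_def)
  have iX2: "integrable M (\<lambda>\<omega>. (X \<omega>)\<^sup>2)" and iY2: "integrable M (\<lambda>\<omega>. (Y \<omega>)\<^sup>2)"
    using X Y mean by (simp_all add: centered_gaussian_square_integrable)
  have iX: "integrable M X" and iY: "integrable M Y"
    using square_integrable_imp_integrable iX2 iY2 mX mY by blast+
  have iXY: "integrable M (\<lambda>\<omega>. X \<omega> * Y \<omega>)"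
    by (rule integrable_mult_if_square_integrable[OF mX mY iX2 iY2])
  \<comment> \<open>Nonnegativity of this quadratic at \<open>c = 1\<close> and \<open>c = - 1\<close> yields
    \<open>\<bar>\<rho>\<bar> \<le> 1\<close>, and its value at \<open>c = \<rho>\<close> is the variance of \<open>W\<close>.\<close>
  have quad: "expectation (\<lambda>\<omega>. (Y \<omega> - c * X \<omega>)\<^sup>2) = 1 - 2 * c * \<rho> + c\<^sup>2" for c
  proof -
    have "(Y \<omega> - c * X \<omega>)\<^sup>2 = (Y \<omega>)\<^sup>2 + (- 2 * c) * (X \<omega> * Y \<omega>) + c\<^sup>2 * (X \<omega>)\<^sup>2" for \<omega>
      by (simp add: power2_eq_square algebra_simps)
    then show ?thesis using iX2 iY2 iXY var by (simp add: \<rho>_def)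
  qed
  have nonneg: "0 \<le> 1 - 2 * c * \<rho> + c\<^sup>2" for c
    unfolding quad[symmetric] by (rule integral_nonneg_AE) simp
  have \<rho>1: "\<bar>\<rho>\<bar> \<le> 1" using nonneg[of 1] nonneg[of "-1"] by auto
  have W: "gaussian_rv M W" using lin[of "- \<rho>" 1] by (simp add: W_def algebra_simps)
  have mean_W: "expectation W = 0" using iX iY mean by (simp add: W_def)
  have var_W: "expectation (\<lambda>\<omega>. (W \<omega>)\<^sup>2) \<le> 1"
    using quad[of \<rho>] by (simp add: W_def power2_eq_square)
  have "gaussian_rv M (\<lambda>\<omega>. s * X \<omega> + t * W \<omega>)" for s t
    using lin[of "s - t * \<rho>" t] by (simp add: W_def algebra_simps)
  moreover have "expectation (\<lambda>\<omega>. X \<omega> * W \<omega>) = 0"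
  proof -
    have "X \<omega> * W \<omega> = X \<omega> * Y \<omega> - \<rho> * (X \<omega>)\<^sup>2" for \<omega>
      by (simp add: W_def power2_eq_square algebra_simps)
    then show ?thesis using iXY iX2 var by (simp add: \<rho>_def)
  qed
  ultimately have ind: "indep_var borel X borel W"
    using uncorrelated_gaussian_indep mean(1) mean_W by blast
  then have ind': "indep_var borel (\<lambda>\<omega>. - X \<omega>) borel W"
    using indep_var_compose[OF ind, of uminus borel "\<lambda>x. x" borel] by (simp add: comp_def)
  have "distr M borel (\<lambda>\<omega>. - X \<omega>) = distr M borel X"
  proof -
    have "gaussian_rv M (\<lambda>\<omega>. - X \<omega>)" using lin[of "-1" 0] by simp
    from centered_gaussian_distr[OF this] centered_gaussian_distr[OF X mean(1)]
    show ?thesis using mean by simp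
  qed
  with ind ind' have law: "distr M (borel \<Otimes>\<^sub>M borel) (\<lambda>\<omega>. (- X \<omega>, W \<omega>)) = distr M (borel \<Otimes>\<^sub>M borel) (\<lambda>\<omega>. (X \<omega>, W \<omega>))"
    unfolding indep_var_distribution_eq by metis
  let ?f = "\<lambda>(x, w). \<bar>x\<bar> powr p * \<bar>w + \<rho> * x\<bar> powr p"
  have f[measurable]: "?f \<in> borel_measurable (borel \<Otimes>\<^sub>M borel)" by measurable
  have sym: "expectation (\<lambda>\<omega>. \<bar>X \<omega>\<bar> powr p * \<bar>Y \<omega>\<bar> powr p)
      = expectation (\<lambda>\<omega>. \<bar>X \<omega>\<bar> powr p * \<bar>W \<omega> - \<rho> * X \<omega>\<bar> powr p)"
    using arg_cong[OF law, of "\<lambda>D. integral\<^sup>L D ?f"] by (simp add: integral_distr W_def)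
  have mom: "integrable M (\<lambda>\<omega>. \<bar>X \<omega>\<bar> powr q)" "integrable M (\<lambda>\<omega>. \<bar>Y \<omega>\<bar> powr q)"
    "integrable M (\<lambda>\<omega>. \<bar>W \<omega>\<bar> powr q)" "expectation (\<lambda>\<omega>. \<bar>X \<omega>\<bar> powr q) = normal_abs_moment q"
    "expectation (\<lambda>\<omega>. \<bar>W \<omega>\<bar> powr q) \<le> normal_abs_moment q" if q: "0 \<le> q" for q
  proof -
    show "integrable M (\<lambda>\<omega>. \<bar>X \<omega>\<bar> powr q)" "integrable M (\<lambda>\<omega>. \<bar>Y \<omega>\<bar> powr q)"
      "integrable M (\<lambda>\<omega>. \<bar>W \<omega>\<bar> powr q)"
      using centered_gaussian_abs_moment(1) X Y W mean mean_W q by blast+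
    show "expectation (\<lambda>\<omega>. \<bar>X \<omega>\<bar> powr q) = normal_abs_moment q"
      using centered_gaussian_abs_moment(2)[OF X mean(1) q] var by simp
    have "sqrt (expectation (\<lambda>\<omega>. (W \<omega>)\<^sup>2)) powr q \<le> 1"
      using var_W q by (intro powr_le1) (auto intro!: integral_nonneg_AE)
    then show "expectation (\<lambda>\<omega>. \<bar>W \<omega>\<bar> powr q) \<le> normal_abs_moment q"
      using centered_gaussian_abs_moment(2)[OF W mean_W q] normal_abs_moment_pos[OF q]
        mult_right_mono[of "sqrt (expectation (\<lambda>\<omega>. (W \<omega>)\<^sup>2)) powr q" 1 "normal_abs_moment q"]
      by simp
  qed
  have iprod: "integrable M (\<lambda>\<omega>. \<bar>X \<omega>\<bar> powr p * \<bar>Z \<omega>\<bar> powr p)"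
    if [measurable]: "Z \<in> borel_measurable M" and "integrable M (\<lambda>\<omega>. \<bar>Z \<omega>\<bar> powr (2 * p))" for Z
  proof (rule integrable_mult_if_square_integrable)
    have sq: "(\<bar>x\<bar> powr p)\<^sup>2 = \<bar>x\<bar> powr (2 * p)" for x :: real
      by (simp add: power2_eq_square powr_add[symmetric])
    show "integrable M (\<lambda>\<omega>. (\<bar>X \<omega>\<bar> powr p)\<^sup>2)" "integrable M (\<lambda>\<omega>. (\<bar>Z \<omega>\<bar> powr p)\<^sup>2)"
      using mom(1)[of "2 * p"] that p2 by (simp_all add: sq)
  qed measurable
  have iXYp: "integrable M (\<lambda>\<omega>. \<bar>X \<omega>\<bar> powr p * \<bar>Y \<omega>\<bar> powr p)"
    using mom(2) p2 by (intro iprod) auto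
  have iXVp: "integrable M (\<lambda>\<omega>. \<bar>X \<omega>\<bar> powr p * \<bar>W \<omega> - \<rho> * X \<omega>\<bar> powr p)"
  proof (rule iprod)
    have G: "gaussian_rv M (\<lambda>\<omega>. W \<omega> - \<rho> * X \<omega>)"
      using lin[of "- 2 * \<rho>" 1] by (simp add: W_def algebra_simps)
    have "expectation (\<lambda>\<omega>. W \<omega> - \<rho> * X \<omega>) = 0" using iX iY mean by (simp add: W_def)
    then show "integrable M (\<lambda>\<omega>. \<bar>W \<omega> - \<rho> * X \<omega>\<bar> powr (2 * p))"
      using centered_gaussian_abs_moment(1)[OF G] p2 by simp
  qed measurable
  have iXWp: "integrable M (\<lambda>\<omega>. \<bar>X \<omega>\<bar> powr p * \<bar>W \<omega>\<bar> powr p)"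
    using mom(3) p2 by (intro iprod) auto
  have prod: "expectation (\<lambda>\<omega>. \<bar>X \<omega>\<bar> powr p * \<bar>W \<omega>\<bar> powr p)
      = expectation (\<lambda>\<omega>. \<bar>X \<omega>\<bar> powr p) * expectation (\<lambda>\<omega>. \<bar>W \<omega>\<bar> powr p)"
  proof (rule indep_var_lebesgue_integral)
    show "indep_var borel (\<lambda>\<omega>. \<bar>X \<omega>\<bar> powr p) borel (\<lambda>\<omega>. \<bar>W \<omega>\<bar> powr p)"
      using indep_var_compose[OF ind, of "\<lambda>x. \<bar>x\<bar> powr p" borel "\<lambda>x. \<bar>x\<bar> powr p" borel]
      by (simp add: comp_def)
  qed (use mom p2 in auto)
  have "2 * expectation (\<lambda>\<omega>. \<bar>X \<omega>\<bar> powr p * \<bar>Y \<omega>\<bar> powr p)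
    = expectation (\<lambda>\<omega>. \<bar>X \<omega>\<bar> powr p * \<bar>Y \<omega>\<bar> powr p + \<bar>X \<omega>\<bar> powr p * \<bar>W \<omega> - \<rho> * X \<omega>\<bar> powr p)"
    using sym iXYp iXVp by simp
  also have "\<dots> \<le> expectation (\<lambda>\<omega>. 2 * (\<bar>X \<omega>\<bar> powr p * \<bar>W \<omega>\<bar> powr p)
      + K * \<rho>\<^sup>2 * (\<bar>X \<omega>\<bar> powr (2 * p) + \<bar>W \<omega>\<bar> powr (2 * p)))"
  proof (rule integral_mono)
    fix \<omega>
    have "Y \<omega> = W \<omega> + \<rho> * X \<omega>" by (simp add: W_def)
    then show "\<bar>X \<omega>\<bar> powr p * \<bar>Y \<omega>\<bar> powr p + \<bar>X \<omega>\<bar> powr p * \<bar>W \<omega> - \<rho> * X \<omega>\<bar> powr p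
      \<le> 2 * (\<bar>X \<omega>\<bar> powr p * \<bar>W \<omega>\<bar> powr p)
      + K * \<rho>\<^sup>2 * (\<bar>X \<omega>\<bar> powr (2 * p) + \<bar>W \<omega>\<bar> powr (2 * p))"
      unfolding K_def using symmetrised_product_le[OF p \<rho>1, of "X \<omega>" "W \<omega>"] by simp
  qed (use iXYp iXVp iXWp mom[of "2 * p"] p2 in auto)
  also have "\<dots> = 2 * (expectation (\<lambda>\<omega>. \<bar>X \<omega>\<bar> powr p) * expectation (\<lambda>\<omega>. \<bar>W \<omega>\<bar> powr p))
      + K * \<rho>\<^sup>2 * (expectation (\<lambda>\<omega>. \<bar>X \<omega>\<bar> powr (2 * p)) + expectation (\<lambda>\<omega>. \<bar>W \<omega>\<bar> powr (2 * p)))"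
    using iXWp mom[of "2 * p"] p2 prod by simp
  also have "\<dots> \<le> 2 * (normal_abs_moment p * normal_abs_moment p)
      + K * \<rho>\<^sup>2 * (normal_abs_moment (2 * p) + normal_abs_moment (2 * p))"
    using mom[of p] mom[of "2 * p"] K p2 normal_abs_moment_pos[of p]
    by (intro add_mono mult_left_mono) auto
  finally show ?thesis by (simp add: K_def \<rho>_def power2_eq_square algebra_simps)
qed

end

section \<open>Correlations of fractional Gaussian noise\<close>

text \<open>The autocorrelation at lag \<open>d\<close> of fractional Gaussian noise, the sequence of unit
  increments of a fractional Brownian motion.\<close>

definition fgn_corr :: "real \<Rightarrow> real \<Rightarrow> real" where
  "fgn_corr H d = (\<bar>d + 1\<bar> powr (2 * H) + \<bar>d - 1\<bar> powr (2 * H) - 2 * \<bar>d\<bar> powr (2 * H)) / 2"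

lemma fgn_corr_0: "fgn_corr H 0 = 1"
  by (simp add: fgn_corr_def)

lemma fgn_corr_abs: "fgn_corr H \<bar>d\<bar> = fgn_corr H d"
proof (cases "0 \<le> d")
  case False
  have "\<bar>- d + 1\<bar> = \<bar>d - 1\<bar>" "\<bar>- d - 1\<bar> = \<bar>d + 1\<bar>" by arith+
  then show ?thesis using False by (simp add: fgn_corr_def)
qed simp

text \<open>The correlation is half of a second difference of \<open>x powr (2 * H)\<close>, so two mean value
  arguments express it by the second derivative, taken at a point beyond \<open>d - 1\<close>.\<close>

lemma fgn_corr_decay:
  assumes H: "0 < H" "H < 1" and d: "1 < d"
  shows "\<bar>fgn_corr H d\<bar> \<le> (d - 1) powr (2 * H - 2)"
proof -
  define h where "h = (\<lambda>x::real. (x + 1) powr (2 * H) - x powr (2 * H))"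
  have "\<exists>z. d - 1 < z \<and> z < d \<and> h d - h (d - 1)
      = (d - (d - 1)) * (2 * H * (z + 1) powr (2 * H - 1) - 2 * H * z powr (2 * H - 1))"
    unfolding h_def
  proof (rule MVT2)
    fix x assume "d - 1 \<le> x"
    then have x: "0 < x" using d by linarith
    show "((\<lambda>x. (x + 1) powr (2 * H) - x powr (2 * H)) has_real_derivative
        2 * H * (x + 1) powr (2 * H - 1) - 2 * H * x powr (2 * H - 1)) (at x)"
      using x DERIV_shift[of "\<lambda>y. y powr (2 * H)" "2 * H * (x + 1) powr (2 * H - 1)" x 1]
      by (intro DERIV_diff has_real_derivative_powr) (simp_all add: has_real_derivative_powr)
  qed simp
  then obtain z where z: "d - 1 < z" "z < d"
    "h d - h (d - 1) = 2 * H * ((z + 1) powr (2 * H - 1) - z powr (2 * H - 1))"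
    by (auto simp: right_diff_distrib)
  have "\<exists>y. z < y \<and> y < z + 1 \<and> (z + 1) powr (2 * H - 1) - z powr (2 * H - 1)
      = (z + 1 - z) * ((2 * H - 1) * y powr (2 * H - 1 - 1))"
    using d z by (intro MVT2 has_real_derivative_powr) auto
  then obtain y where y: "z < y" "y < z + 1"
    "(z + 1) powr (2 * H - 1) - z powr (2 * H - 1) = (2 * H - 1) * y powr (2 * H - 2)" by auto
  have "2 * fgn_corr H d = h d - h (d - 1)" using d by (simp add: fgn_corr_def h_def)
  then have "fgn_corr H d = H * (2 * H - 1) * y powr (2 * H - 2)" using z y by simp
  then have "\<bar>fgn_corr H d\<bar> = H * \<bar>2 * H - 1\<bar> * y powr (2 * H - 2)" using H by (simp add: abs_mult)
  also have "\<dots> \<le> 1 * y powr (2 * H - 2)"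
    using H mult_mono[of H 1 "\<bar>2 * H - 1\<bar>" 1] by (intro mult_right_mono) auto
  also have "\<dots> \<le> 1 * (d - 1) powr (2 * H - 2)"
    using H d y z by (intro mult_left_mono powr_mono2') auto
  finally show ?thesis by simp
qed

text \<open>The place where \<open>H < 3 / 4\<close> is decisive: the squares decay like
  \<open>d powr (4 * H - 4)\<close>, and \<open>4 * H - 4 < - 1\<close>.\<close>

lemma summable_fgn_corr_square:
  assumes H: "0 < H" "H < 3 / 4"
  shows "summable (\<lambda>d::nat. (fgn_corr H (real d))\<^sup>2)"
proof -
  have "summable (\<lambda>d. (fgn_corr H (real (d + 2)))\<^sup>2)"
  proof (rule summable_comparison_test')
    have "summable (\<lambda>d. real d powr (4 * H - 4))" using H by (simp add: summable_real_powr_iff)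
    then show "summable (\<lambda>d. real (Suc d) powr (4 * H - 4))" by (subst summable_Suc_iff)
    fix d :: nat
    have "\<bar>fgn_corr H (real (d + 2))\<bar> \<le> real (Suc d) powr (2 * H - 2)"
      using fgn_corr_decay[of H "real (d + 2)"] H by (simp add: add.commute)
    then have "\<bar>fgn_corr H (real (d + 2))\<bar>\<^sup>2 \<le> (real (Suc d) powr (2 * H - 2))\<^sup>2"
      by (rule power_mono) simp
    also have "\<dots> = real (Suc d) powr (4 * H - 4)"
      by (simp add: power2_eq_square powr_add[symmetric])
    finally show "norm ((fgn_corr H (real (d + 2)))\<^sup>2) \<le> real (Suc d) powr (4 * H - 4)" by simp
  qed
  then show ?thesis by (subst (asm) summable_iff_shift)
qed

text \<open>A row sum of a Toeplitz matrix: each distance to \<open>j\<close> occurs at most twice.\<close>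

lemma sum_distance_le_suminf:
  fixes f :: "nat \<Rightarrow> real"
  assumes f: "summable f" "\<And>d. 0 \<le> f d"
  shows "(\<Sum>k<n. f (if k \<le> j then j - k else k - j)) \<le> 2 * suminf f"
proof -
  let ?g = "\<lambda>k. f (if k \<le> j then j - k else k - j)"
  have "(\<Sum>k<n. ?g k) \<le> (\<Sum>k\<in>{..j} \<union> {j<..<n}. ?g k)"
    by (rule sum_mono2) (use f in auto)
  also have "\<dots> = (\<Sum>k\<le>j. ?g k) + (\<Sum>k\<in>{j<..<n}. ?g k)" by (rule sum.union_disjoint) auto
  also have "(\<Sum>k\<le>j. ?g k) = sum f {..j}"
    by (rule sum.reindex_bij_witness[of _ "\<lambda>i. j - i" "\<lambda>i. j - i"]) auto
  also have "(\<Sum>k\<in>{j<..<n}. ?g k) = sum f {0<..<n - j}"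
    by (rule sum.reindex_bij_witness[of _ "\<lambda>i. i + j" "\<lambda>i. i - j"]) auto
  also have "sum f {..j} + sum f {0<..<n - j} \<le> suminf f + suminf f"
    using f by (intro add_mono sum_le_suminf) auto
  finally show ?thesis by simp
qed

section \<open>Variance of the normalized power variation\<close>

definition scaled_increment :: "real \<Rightarrow> (real \<Rightarrow> 'a \<Rightarrow> real) \<Rightarrow> nat \<Rightarrow> nat \<Rightarrow> 'a \<Rightarrow> real" where
  "scaled_increment H B n j \<omega>
     = real n powr H * (B ((real j + 1) / real n) \<omega> - B (real j / real n) \<omega>)"

text \<open>The power variation rescaled by the factor \<open>real n powr (p * H - 1)\<close>, which by self-similarity
  makes its expectation the same for all \<open>n\<close>.\<close>

definition mean_power :: "real \<Rightarrow> real \<Rightarrow> (real \<Rightarrow> 'a \<Rightarrow> real) \<Rightarrow> nat \<Rightarrow> 'a \<Rightarrow> real" where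
  "mean_power p H B n \<omega> = (\<Sum>j<n. \<bar>scaled_increment H B n j \<omega>\<bar> powr p) / real n"

lemma power_variation_eq_mean_power:
  assumes "1 \<le> n"
  shows "power_variation p B n \<omega> = real n powr (1 - p * H) * mean_power p H B n \<omega>"
proof -
  have "\<bar>scaled_increment H B n j \<omega>\<bar> powr p
    = real n powr (p * H) * \<bar>B ((real j + 1) / real n) \<omega> - B (real j / real n) \<omega>\<bar> powr p" for j
    by (simp add: scaled_increment_def abs_mult powr_mult powr_powr mult.commute)
  then have "mean_power p H B n \<omega> = real n powr (p * H) * power_variation p B n \<omega> / real n"
    by (simp add: mean_power_def power_variation_def sum_distrib_left)
  then show ?thesis using assms by (simp add: powr_diff)
qed

context
  fixes M :: "'a measure" and H :: real and B :: "real \<Rightarrow> 'a \<Rightarrow> real"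
  assumes fbm: "fractional_brownian_motion M H B"
begin

text \<open>The definition of a Gaussian process ranges over sets of times, whereas the times
  \<open>s\<close>, \<open>t\<close>, \<open>u\<close>, \<open>v\<close> may coincide, as the endpoints of adjacent intervals do.
  Coefficients of equal times are therefore added up.\<close>

lemma fbm_gaussian_combination:
  "gaussian_rv M (\<lambda>\<omega>. a * B s \<omega> + b * B t \<omega> + c * B u \<omega> + d * B v \<omega>)"
proof -
  let ?c = "\<lambda>x. (if x = s then a else 0) + (if x = t then b else 0)
    + (if x = u then c else 0) + (if x = v then d else 0)"
  have "(\<Sum>x\<in>{s, t, u, v}. ?c x * B x \<omega>)
    = (\<Sum>x\<in>{s, t, u, v}. (if x = s then a * B x \<omega> else 0)) + (\<Sum>x\<in>{s, t, u, v}. (if x = t then b * B x \<omega> else 0))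
    + (\<Sum>x\<in>{s, t, u, v}. (if x = u then c * B x \<omega> else 0)) + (\<Sum>x\<in>{s, t, u, v}. (if x = v then d * B x \<omega> else 0))" for \<omega>
    unfolding sum.distrib[symmetric] by (rule sum.cong) (auto simp: algebra_simps)
  then have *: "(\<Sum>x\<in>{s, t, u, v}. ?c x * B x \<omega>) = a * B s \<omega> + b * B t \<omega> + c * B u \<omega> + d * B v \<omega>" for \<omega>
    by (simp only: sum.delta finite_insert finite.emptyI insert_iff simp_thms if_True)
  have "gaussian_rv M (\<lambda>\<omega>. \<Sum>x\<in>{s, t, u, v}. ?c x * B x \<omega>)"
    using fbm by (simp add: fractional_brownian_motion_def gaussian_process_def del: sum.insert)
  then show ?thesis unfolding * .
qed

lemma fbm_measurable: "B t \<in> borel_measurable M"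
  using fbm_gaussian_combination[of 1 t 0 t 0 t 0 t] by (simp add: gaussian_rv_def)

lemma scaled_increment_measurable [measurable]: "scaled_increment H B n j \<in> borel_measurable M"
  unfolding scaled_increment_def using fbm_measurable by measurable

lemma mean_power_measurable [measurable]: "mean_power p H B n \<in> borel_measurable M"
  unfolding mean_power_def by measurable

lemma scaled_increment_gaussian_pair:
  "gaussian_rv M (\<lambda>\<omega>. a * scaled_increment H B n j \<omega> + b * scaled_increment H B n k \<omega>)"
proof -
  let ?r = "real n powr H"
  have "a * scaled_increment H B n j \<omega> + b * scaled_increment H B n k \<omega>
    = (a * ?r) * B ((real j + 1) / real n) \<omega> + (- a * ?r) * B (real j / real n) \<omega>
    + (b * ?r) * B ((real k + 1) / real n) \<omega> + (- b * ?r) * B (real k / real n) \<omega>" for \<omega>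
    by (simp add: scaled_increment_def algebra_simps)
  then show ?thesis using fbm_gaussian_combination by presburger
qed

lemma fbm_integrable: "integrable M (B t)" "integrable M (\<lambda>\<omega>. B s \<omega> * B t \<omega>)"
proof -
  interpret prob_space M using fbm by (simp add: fractional_brownian_motion_def)
  have sq: "integrable M (\<lambda>\<omega>. (B t \<omega>)\<^sup>2)" for t
    using fbm_gaussian_combination[of 1 t 0 t 0 t 0 t] fbm
    by (intro centered_gaussian_square_integrable) (simp_all add: fractional_brownian_motion_def)
  show "integrable M (B t)"
    by (rule square_integrable_imp_integrable[OF fbm_measurable sq])
  show "integrable M (\<lambda>\<omega>. B s \<omega> * B t \<omega>)"
    by (rule integrable_mult_if_square_integrable[OF fbm_measurable fbm_measurable sq sq])
qed

lemma scaled_increment_mean: "integral\<^sup>L M (scaled_increment H B n j) = 0"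
  unfolding scaled_increment_def using fbm_integrable fbm
  by (simp add: fractional_brownian_motion_def)

lemma scaled_increment_covariance:
  assumes n: "1 \<le> n"
  shows "integral\<^sup>L M (\<lambda>\<omega>. scaled_increment H B n j \<omega> * scaled_increment H B n k \<omega>)
    = fgn_corr H (real j - real k)"
proof -
  let ?r = "real n powr (2 * H)"
  let ?s = "\<lambda>i. (real i + 1) / real n" and ?t = "\<lambda>i. real i / real n"
  have E: "integral\<^sup>L M (\<lambda>\<omega>. B s \<omega> * B t \<omega>)
      = (\<bar>s\<bar> powr (2 * H) + \<bar>t\<bar> powr (2 * H) - \<bar>s - t\<bar> powr (2 * H)) / 2" for s t
    using fbm by (simp add: fractional_brownian_motion_def)
  \<comment> \<open>The four covariances of the endpoints: the contributions of single times cancel.\<close>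
  have collect: "r * ((a + b - x) / 2 - (a + d - y) / 2 - (c + b - z) / 2 + (c + d - w) / 2)
      = r * (y + z - x - w) / 2" for r a b c d x y z w :: real
    by (simp add: field_simps)
  have r: "?r = real n powr H * real n powr H" by (simp add: powr_add[symmetric])
  have "scaled_increment H B n j \<omega> * scaled_increment H B n k \<omega>
    = ?r * (B (?s j) \<omega> * B (?s k) \<omega> - B (?s j) \<omega> * B (?t k) \<omega> - B (?t j) \<omega> * B (?s k) \<omega> + B (?t j) \<omega> * B (?t k) \<omega>)" for \<omega>
    unfolding scaled_increment_def r by (simp add: algebra_simps)
  then have "integral\<^sup>L M (\<lambda>\<omega>. scaled_increment H B n j \<omega> * scaled_increment H B n k \<omega>)
    = ?r * (integral\<^sup>L M (\<lambda>\<omega>. B (?s j) \<omega> * B (?s k) \<omega>) - integral\<^sup>L M (\<lambda>\<omega>. B (?s j) \<omega> * B (?t k) \<omega>)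
      - integral\<^sup>L M (\<lambda>\<omega>. B (?t j) \<omega> * B (?s k) \<omega>) + integral\<^sup>L M (\<lambda>\<omega>. B (?t j) \<omega> * B (?t k) \<omega>))"
    using fbm_integrable(2) by simp
  also have "\<dots> = ?r * (\<bar>?s j - ?t k\<bar> powr (2 * H) + \<bar>?t j - ?s k\<bar> powr (2 * H)
        - \<bar>?s j - ?s k\<bar> powr (2 * H) - \<bar>?t j - ?t k\<bar> powr (2 * H)) / 2"
    unfolding E by (rule collect)
  finally have "integral\<^sup>L M (\<lambda>\<omega>. scaled_increment H B n j \<omega> * scaled_increment H B n k \<omega>)
    = (?r * \<bar>?s j - ?t k\<bar> powr (2 * H) + ?r * \<bar>?t j - ?s k\<bar> powr (2 * H)
        - ?r * \<bar>?s j - ?s k\<bar> powr (2 * H) - ?r * \<bar>?t j - ?t k\<bar> powr (2 * H)) / 2"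
    by (simp only: distrib_left right_diff_distrib)
  moreover have "?r * \<bar>x / real n\<bar> powr (2 * H) = \<bar>x\<bar> powr (2 * H)" for x
    using n by (simp add: abs_divide powr_divide)
  moreover have "?s j - ?t k = (real j - real k + 1) / real n" "?t j - ?s k = (real j - real k - 1) / real n"
    "?s j - ?s k = (real j - real k) / real n" "?t j - ?t k = (real j - real k) / real n"
    by (simp_all add: diff_divide_distrib add_divide_distrib)
  ultimately show ?thesis by (simp only: fgn_corr_def) simp
qed

text \<open>The mean square deviation is the average over all \<open>n\<^sup>2\<close> pairs of increments of the
  covariances of their \<open>p\<close>-th absolute powers. These are bounded by squared correlations, whose
  row sums stay bounded, so the double sum is of order \<open>n\<close> instead of \<open>n\<^sup>2\<close>.\<close>

lemma mean_power_variance_le: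
  assumes H34: "H < 3 / 4" and p: "p = 2 \<or> 3 \<le> p"
  obtains K where "0 \<le> K"
    and "\<And>n. 1 \<le> n \<Longrightarrow> integrable M (\<lambda>\<omega>. (mean_power p H B n \<omega> - normal_abs_moment p)\<^sup>2)"
    and "\<And>n. 1 \<le> n \<Longrightarrow>
      integral\<^sup>L M (\<lambda>\<omega>. (mean_power p H B n \<omega> - normal_abs_moment p)\<^sup>2) \<le> K / real n"
proof -
  interpret prob_space M using fbm by (simp add: fractional_brownian_motion_def)
  have H: "0 < H" using fbm by (simp add: fractional_brownian_motion_def)
  have p2: "2 \<le> p" using p by auto
  define m where "m = normal_abs_moment p"
  define C where "C = p * (2 * p - 3) * 4 powr p * normal_abs_moment (2 * p)"
  define R where "R = (\<lambda>d::nat. (fgn_corr H (real d))\<^sup>2)"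
  have C: "0 \<le> C" using p2 normal_abs_moment_pos[of "2 * p"] by (simp add: C_def)
  have R: "summable R" "\<And>d. 0 \<le> R d" using summable_fgn_corr_square[OF H H34] by (auto simp: R_def)
  have main: "integrable M (\<lambda>\<omega>. (mean_power p H B n \<omega> - m)\<^sup>2)
      \<and> expectation (\<lambda>\<omega>. (mean_power p H B n \<omega> - m)\<^sup>2) \<le> (2 * C * suminf R) / real n"
    if n: "1 \<le> n" for n
  proof -
    let ?X = "scaled_increment H B n"
    let ?U = "\<lambda>j \<omega>. \<bar>?X j \<omega>\<bar> powr p"
    have G: "gaussian_rv M (?X j)" for j using scaled_increment_gaussian_pair[of 1 n j 0 j] by simp
    have v: "expectation (\<lambda>\<omega>. (?X j \<omega>)\<^sup>2) = 1" for j
      using scaled_increment_covariance[OF n, of j j] by (simp add: fgn_corr_0 power2_eq_square)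
    have iU: "integrable M (?U j)" and EU: "expectation (?U j) = m" for j
      using centered_gaussian_abs_moment[OF G[of j] scaled_increment_mean, of p] p2 v by (auto simp: m_def)
    have iUU: "integrable M (\<lambda>\<omega>. ?U j \<omega> * ?U k \<omega>)" for j k
    proof (rule integrable_mult_if_square_integrable)
      have "(?U j \<omega>)\<^sup>2 = \<bar>?X j \<omega>\<bar> powr (2 * p)" for j \<omega>
        by (simp add: power2_eq_square powr_add[symmetric])
      then show "integrable M (\<lambda>\<omega>. (?U j \<omega>)\<^sup>2)" "integrable M (\<lambda>\<omega>. (?U k \<omega>)\<^sup>2)"
        using centered_gaussian_abs_moment(1)[OF G[of j] scaled_increment_mean, of "2 * p"]
          centered_gaussian_abs_moment(1)[OF G[of k] scaled_increment_mean, of "2 * p"] p2 by auto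
    qed measurable
    have cov: "expectation (\<lambda>\<omega>. (?U j \<omega> - m) * (?U k \<omega> - m)) \<le> C * R (if k \<le> j then j - k else k - j)" for j k
    proof -
      have "(?U j \<omega> - m) * (?U k \<omega> - m) = ?U j \<omega> * ?U k \<omega> - m * ?U j \<omega> - m * ?U k \<omega> + m\<^sup>2" for \<omega>
        by (simp add: power2_eq_square algebra_simps)
      then have "expectation (\<lambda>\<omega>. (?U j \<omega> - m) * (?U k \<omega> - m)) = expectation (\<lambda>\<omega>. ?U j \<omega> * ?U k \<omega>) - m\<^sup>2"
        using iU iUU EU by (simp add: prob_space power2_eq_square)
      also have "\<dots> \<le> C * (expectation (\<lambda>\<omega>. ?X j \<omega> * ?X k \<omega>))\<^sup>2"
        using expectation_abs_powr_product_le[OF scaled_increment_gaussian_pair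
            scaled_increment_mean scaled_increment_mean v v p, of j k] by (simp add: m_def C_def)
      also have "expectation (\<lambda>\<omega>. ?X j \<omega> * ?X k \<omega>) = fgn_corr H \<bar>real j - real k\<bar>"
        by (simp add: scaled_increment_covariance[OF n] fgn_corr_abs)
      also have "\<bar>real j - real k\<bar> = real (if k \<le> j then j - k else k - j)" by (simp add: of_nat_diff)
      finally show ?thesis by (simp add: R_def)
    qed
    have i: "integrable M (\<lambda>\<omega>. (?U j \<omega> - m) * (?U k \<omega> - m))" for j k
      unfolding left_diff_distrib right_diff_distrib using iU iUU by auto
    have eq: "(mean_power p H B n \<omega> - m)\<^sup>2 = (\<Sum>j<n. \<Sum>k<n. (?U j \<omega> - m) * (?U k \<omega> - m)) / (real n)\<^sup>2" for \<omega>
    proof -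
      have "mean_power p H B n \<omega> - m = (\<Sum>j<n. ?U j \<omega> - m) / real n"
        using n by (simp add: mean_power_def sum_subtractf diff_divide_distrib)
      then show ?thesis by (simp add: power_divide power2_eq_square sum_product)
    qed
    have "expectation (\<lambda>\<omega>. (mean_power p H B n \<omega> - m)\<^sup>2)
      = (\<Sum>j<n. \<Sum>k<n. expectation (\<lambda>\<omega>. (?U j \<omega> - m) * (?U k \<omega> - m))) / (real n)\<^sup>2"
      unfolding eq using i by simp
    also have "\<dots> \<le> (\<Sum>j<n. \<Sum>k<n. C * R (if k \<le> j then j - k else k - j)) / (real n)\<^sup>2"
      by (intro divide_right_mono sum_mono cov) simp
    also have "\<dots> \<le> (\<Sum>j<n. C * (2 * suminf R)) / (real n)\<^sup>2"
      using sum_distance_le_suminf[OF R] C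
      by (intro divide_right_mono sum_mono) (simp_all add: sum_distrib_left[symmetric] mult_left_mono)
    also have "\<dots> = (2 * C * suminf R) / real n" using n by (simp add: power2_eq_square)
    finally show ?thesis unfolding eq using i by simp
  qed
  show ?thesis
  proof (rule that)
    show "0 \<le> 2 * C * suminf R" using C suminf_nonneg[OF R] by simp
  qed (use main in \<open>auto simp: m_def\<close>)
qed

end

section \<open>Error of the estimator\<close>

lemma abs_ln_diff_le:
  fixes x y c :: real
  assumes "0 < c" "c \<le> x" "c \<le> y"
  shows "\<bar>ln x - ln y\<bar> \<le> \<bar>x - y\<bar> / c"
proof -
  have *: "ln u - ln v \<le> \<bar>u - v\<bar> / c" if "c \<le> u" "c \<le> v" for u v
  proof -
    have "ln u - ln v \<le> (u - v) / v" using assms that by (intro ln_diff_le) auto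
    also have "\<dots> \<le> \<bar>u - v\<bar> / v" using assms that by (intro divide_right_mono) auto
    also have "\<dots> \<le> \<bar>u - v\<bar> / c" using assms that by (intro divide_left_mono) auto
    finally show ?thesis .
  qed
  show ?thesis using *[of x y] *[of y x] assms by (simp add: abs_minus_commute abs_le_iff)
qed

text \<open>The deterministic factor \<open>real L powr (1 - p * H)\<close> in the ratio of power variations is what
  makes the estimator aim at \<open>H\<close>; the rest is the error.\<close>

lemma hurst_estimator_error:
  assumes "1 < L" "1 \<le> n" "p \<noteq> 0" and "0 < mean_power p H B n \<omega>" "0 < mean_power p H B (L * n) \<omega>"
  shows "hurst_estimator p B L n \<omega> - H
    = (ln (mean_power p H B n \<omega>) - ln (mean_power p H B (L * n) \<omega>)) / (p * ln (real L))"
proof -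
  have "ln (power_variation p B k \<omega>) = (1 - p * H) * ln (real k) + ln (mean_power p H B k \<omega>)"
    and "0 < power_variation p B k \<omega>"
    if "1 \<le> k" "0 < mean_power p H B k \<omega>" for k
    using that by (simp_all add: power_variation_eq_mean_power[OF that(1), of p B \<omega> H] ln_mult ln_powr)
  note V = this
  have Ln: "1 \<le> L * n" and ln_Ln: "ln (real (L * n)) = ln (real L) + ln (real n)"
    using assms by (simp_all add: ln_mult)
  have "ln (variation_ratio p B L n \<omega>)
      = ln (power_variation p B (L * n) \<omega>) - ln (power_variation p B n \<omega>)"
    unfolding variation_ratio_def using V(2)[OF assms(2,4)] V(2)[OF Ln assms(5)] by (simp add: ln_div)
  also have "\<dots> = (1 - p * H) * ln (real L)
      + ln (mean_power p H B (L * n) \<omega>) - ln (mean_power p H B n \<omega>)"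
    unfolding V(1)[OF assms(2,4)] V(1)[OF Ln assms(5)] ln_Ln by (simp add: distrib_left)
  finally have *: "ln (variation_ratio p B L n \<omega>) = (1 - p * H) * ln (real L)
      + ln (mean_power p H B (L * n) \<omega>) - ln (mean_power p H B n \<omega>)" .
  have "0 < ln (real L)" using assms(1) by simp
  then show ?thesis using assms(3) unfolding hurst_estimator_def * by (simp add: field_simps)
qed

theorem proposition5p1:
  fixes M :: "'a measure" and B :: "real \<Rightarrow> 'a \<Rightarrow> real"
    and H p :: real and L :: nat
  assumes "fractional_brownian_motion M H B"
    and "0 < H" and "H < 3 / 4"
    and "p = 2 \<or> 3 \<le> p"
    and "1 < L"
  shows "converges_in_probability M
    (\<lambda>n \<omega>. sqrt (real n / ln (real n)) * (hurst_estimator p B L n \<omega> - H)) (\<lambda>_. 0)"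
proof -
  note fbm = assms(1)
  interpret prob_space M using fbm by (simp add: fractional_brownian_motion_def)
  note [measurable] = fbm_measurable[OF fbm] mean_power_measurable[OF fbm]
  let ?S = "mean_power p H B"
  define m where "m = normal_abs_moment p"
  have p2: "2 \<le> p" and m: "0 < m" using assms(4) normal_abs_moment_pos[of p] by (auto simp: m_def)
  obtain K where K: "0 \<le> K" "\<And>n. 1 \<le> n \<Longrightarrow> integrable M (\<lambda>\<omega>. (?S n \<omega> - m)\<^sup>2)"
    "\<And>n. 1 \<le> n \<Longrightarrow> expectation (\<lambda>\<omega>. (?S n \<omega> - m)\<^sup>2) \<le> K / real n"
    unfolding m_def by (rule mean_power_variance_le[OF fbm assms(3,4)]) blast
  \<comment> \<open>Stated for all \<open>k \<ge> n\<close> so that it covers both \<open>k = n\<close> and \<open>k = L * n\<close>.\<close>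
  have cheb: "prob {\<omega> \<in> space M. \<delta> \<le> \<bar>?S k \<omega> - m\<bar>} \<le> K / (real n * \<delta>\<^sup>2)"
    if "0 < \<delta>" "1 \<le> n" "n \<le> k" for \<delta> n k
  proof -
    have "prob {\<omega> \<in> space M. \<delta> \<le> \<bar>?S k \<omega> - m\<bar>} \<le> expectation (\<lambda>\<omega>. (?S k \<omega> - m)\<^sup>2) / \<delta>\<^sup>2"
      using that K(2)[of k] by (intro second_moment_method) auto
    also have "\<dots> \<le> (K / real n) / \<delta>\<^sup>2"
    proof (rule divide_right_mono)
      have "K / real k \<le> K / real n" using that K(1) by (intro divide_left_mono) auto
      then show "expectation (\<lambda>\<omega>. (?S k \<omega> - m)\<^sup>2) \<le> K / real n" using K(3)[of k] that by simp
    qed simp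
    finally show ?thesis by simp
  qed
  show ?thesis
    unfolding converges_in_probability_def
  proof (intro conjI allI impI)
    show "(\<lambda>\<omega>. sqrt (real n / ln (real n)) * (hurst_estimator p B L n \<omega> - H)) \<in> borel_measurable M" for n
      unfolding hurst_estimator_def variation_ratio_def power_variation_def by measurable
    fix \<epsilon> :: real assume \<epsilon>: "0 < \<epsilon>"
    define c where "c = \<epsilon> * (p * ln (real L))"
    have lnL: "0 < ln (real L)" using assms(5) by simp
    have c: "0 < c" using \<epsilon> p2 lnL by (simp add: c_def)
    let ?Z = "\<lambda>n \<omega>. sqrt (real n / ln (real n)) * (hurst_estimator p B L n \<omega> - H)"
    have bound: "prob {\<omega> \<in> space M. \<bar>?Z n \<omega> - 0\<bar> > \<epsilon>}
        \<le> 2 * K * (4 / (m\<^sup>2 * real n) + 16 / (c\<^sup>2 * m\<^sup>2 * ln (real n)))" if n: "2 \<le> n" for n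
    proof -
      define a where "a = sqrt (real n / ln (real n))"
      have ln: "0 < ln (real n)" using n by simp
      have a: "0 < a" "a\<^sup>2 = real n / ln (real n)" using n ln by (simp_all add: a_def)
      \<comment> \<open>Deviations up to \<open>m / 2\<close> keep both mean powers above \<open>m / 2\<close>, where the logarithm has
        Lipschitz constant \<open>2 / m\<close>; the second bound makes the rescaled error at most \<open>\<epsilon>\<close>.\<close>
      define \<delta> where "\<delta> = min (m / 2) (c * m / (4 * a))"
      have \<delta>: "0 < \<delta>" "\<delta> \<le> m / 2" "\<delta> \<le> c * m / (4 * a)" using m c a by (auto simp: \<delta>_def)
      have nLn: "n \<le> L * n" using assms(5) by simp
      let ?D = "\<lambda>k. {\<omega> \<in> space M. \<delta> \<le> \<bar>?S k \<omega> - m\<bar>}"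
      have "{\<omega> \<in> space M. \<bar>?Z n \<omega> - 0\<bar> > \<epsilon>} \<subseteq> ?D n \<union> ?D (L * n)"
      proof (rule subsetI, rule ccontr)
        fix \<omega> assume \<omega>: "\<omega> \<in> {\<omega> \<in> space M. \<bar>?Z n \<omega> - 0\<bar> > \<epsilon>}" "\<omega> \<notin> ?D n \<union> ?D (L * n)"
        then have d: "\<bar>?S n \<omega> - m\<bar> < \<delta>" "\<bar>?S (L * n) \<omega> - m\<bar> < \<delta>" by auto
        then have S: "m / 2 \<le> ?S n \<omega>" "m / 2 \<le> ?S (L * n) \<omega>" using \<delta> by linarith+
        have "\<bar>ln (?S n \<omega>) - ln (?S (L * n) \<omega>)\<bar> \<le> \<bar>?S n \<omega> - ?S (L * n) \<omega>\<bar> / (m / 2)"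
          using S m by (intro abs_ln_diff_le) auto
        also have "\<dots> \<le> (2 * \<delta>) / (m / 2)" using d m by (intro divide_right_mono) auto
        also have "\<dots> \<le> (2 * (c * m / (4 * a))) / (m / 2)"
          using \<delta> m by (intro divide_right_mono mult_left_mono) auto
        also have "\<dots> = c / a" using m by simp
        finally have le: "a * \<bar>ln (?S n \<omega>) - ln (?S (L * n) \<omega>)\<bar> \<le> c" using a by (simp add: field_simps)
        have "?Z n \<omega> = a * (ln (?S n \<omega>) - ln (?S (L * n) \<omega>)) / (p * ln (real L))"
          using hurst_estimator_error[of L n p H B \<omega>] assms(5) n p2 S m by (simp add: a_def)
        then have "\<bar>?Z n \<omega>\<bar> = a * \<bar>ln (?S n \<omega>) - ln (?S (L * n) \<omega>)\<bar> / (p * ln (real L))"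
          using a p2 lnL by (simp add: abs_mult)
        also have "\<dots> \<le> c / (p * ln (real L))" using le p2 lnL by (intro divide_right_mono) auto
        also have "\<dots> = \<epsilon>" using p2 lnL by (simp add: c_def)
        finally show False using \<omega>(1) by simp
      qed
      then have "prob {\<omega> \<in> space M. \<bar>?Z n \<omega> - 0\<bar> > \<epsilon>} \<le> prob (?D n \<union> ?D (L * n))"
        by (intro finite_measure_mono) auto
      also have "\<dots> \<le> prob (?D n) + prob (?D (L * n))" by (intro measure_Un_le) auto
      also have "\<dots> \<le> K / (real n * \<delta>\<^sup>2) + K / (real n * \<delta>\<^sup>2)"
        using \<delta> n nLn by (intro add_mono cheb) auto
      also have "\<dots> = 2 * K * (inverse (\<delta>\<^sup>2) / real n)" by (simp add: field_simps)
      also have "\<dots> \<le> 2 * K * ((4 / m\<^sup>2 + 16 * a\<^sup>2 / (c\<^sup>2 * m\<^sup>2)) / real n)"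
      proof (intro mult_left_mono divide_right_mono)
        have "inverse (\<delta>\<^sup>2) \<le> max (inverse ((m / 2)\<^sup>2)) (inverse ((c * m / (4 * a))\<^sup>2))"
          by (simp add: \<delta>_def min_def)
        also have "\<dots> \<le> inverse ((m / 2)\<^sup>2) + inverse ((c * m / (4 * a))\<^sup>2)" by simp
        also have "\<dots> = 4 / m\<^sup>2 + 16 * a\<^sup>2 / (c\<^sup>2 * m\<^sup>2)"
          by (simp add: power_divide power_mult_distrib inverse_eq_divide)
        finally show "inverse (\<delta>\<^sup>2) \<le> 4 / m\<^sup>2 + 16 * a\<^sup>2 / (c\<^sup>2 * m\<^sup>2)" .
      qed (use K in auto)
      also have "\<dots> = 2 * K * (4 / (m\<^sup>2 * real n) + 16 / (c\<^sup>2 * m\<^sup>2 * ln (real n)))"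
        using n ln m c by (simp add: a add_divide_distrib)
      finally show ?thesis .
    qed
    show "(\<lambda>n. prob {\<omega> \<in> space M. \<bar>?Z n \<omega> - 0\<bar> > \<epsilon>}) \<longlonglongrightarrow> 0"
    proof (rule tendsto_sandwich[of "\<lambda>_. 0"])
      show "\<forall>\<^sub>F n in sequentially. prob {\<omega> \<in> space M. \<bar>?Z n \<omega> - 0\<bar> > \<epsilon>}
          \<le> 2 * K * (4 / (m\<^sup>2 * real n) + 16 / (c\<^sup>2 * m\<^sup>2 * ln (real n)))"
        using eventually_ge_at_top[of 2] by eventually_elim (rule bound)
      have "filterlim (\<lambda>n. ln (real n)) at_top sequentially"
        by (rule filterlim_compose[OF ln_at_top filterlim_real_sequentially])
      then have "(\<lambda>n. inverse (ln (real n))) \<longlonglongrightarrow> 0" by (rule tendsto_inverse_0_at_top)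
      then have "(\<lambda>n. 2 * K * (4 / m\<^sup>2 * inverse (real n) + 16 / (c\<^sup>2 * m\<^sup>2) * inverse (ln (real n))))
          \<longlonglongrightarrow> 2 * K * (4 / m\<^sup>2 * 0 + 16 / (c\<^sup>2 * m\<^sup>2) * 0)"
        by (intro tendsto_add tendsto_mult tendsto_const lim_inverse_n)
      then show "(\<lambda>n. 2 * K * (4 / (m\<^sup>2 * real n) + 16 / (c\<^sup>2 * m\<^sup>2 * ln (real n)))) \<longlonglongrightarrow> 0"
        by (simp add: field_simps)
    qed (auto)
  qed simp
qed

end
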